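(* Let $K$ be an infinite field, let $m<n$ be positive integers, let $T=(T_{ijk})_{1\le i\le m,\,1\le j\le n,\,1\le k\le 2}$ be an $m\times n\times 2$-tensor of independent indeterminates, and put $X=(T_{ij1})$, $Y=(T_{ij2})$. Let $G=\mathrm{SL}(m,K)\times\mathrm{SL}(n,K)$ act on $K[T]$ by $K$-algebra automorphisms such that $(P,Q)$ sends $X$ to $P^\top XQ$ and $Y$ to $P^\top YQ$, and let $\mathrm{SL}(2,K)$ act on $K[T]$ by $K$-algebra automorphisms such that $\begin{pmatrix}a&b\\ c&d\end{pmatrix}$ sends $X$ to $aX+cY$ and $Y$ to $bX+dY$. These two actions commute and define an action of $G\times\mathrm{SL}(2,K)$ on $K[T]$. Then $$K[T]^{G\times\mathrm{SL}(2,K)}=K[T]^{G}.$$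
   Context: For a group $H$ acting on a ring $R$, $R^H$ denotes the subring of $H$-invariant elements. *)

theory Defs
  imports
    "HOL-Analysis.Determinants"
    "HOL-Algebra.Group_Action"
    "HOL-Library.Poly_Mapping"
    "HOL-Library.Numeral_Type"
begin

section \<open>Polynomial rings and substitution\<close>

text \<open>
  A polynomial over \<open>'k\<close> with indeterminates indexed by \<open>'v\<close> is a finitely supported family of
  coefficients indexed by monomials, and a monomial is a finitely supported family of exponents.
  The ring structure is the convolution product of \<open>HOL-Library.Poly_Mapping\<close>.
\<close>

type_synonym ('v, 'k) mpoly = "('v \<Rightarrow>\<^sub>0 nat) \<Rightarrow>\<^sub>0 'k"

definition Const :: "'k \<Rightarrow> ('v, 'k::comm_ring_1) mpoly"
  where "Const c = Poly_Mapping.single 0 c"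

definition Var :: "'v \<Rightarrow> ('v, 'k::comm_ring_1) mpoly"
  where "Var v = Poly_Mapping.single (Poly_Mapping.single v 1) 1"

definition poly_subst ::
  "('v \<Rightarrow> ('w, 'k) mpoly) \<Rightarrow> ('v, 'k) mpoly \<Rightarrow> ('w, 'k::comm_ring_1) mpoly"
  where "poly_subst \<sigma> f =
    (\<Sum>u\<in>Poly_Mapping.keys f. Const (Poly_Mapping.lookup f u) *
       (\<Prod>v\<in>Poly_Mapping.keys u. \<sigma> v ^ Poly_Mapping.lookup u v))"


section \<open>The generic tensor and the two actions\<close>

text \<open>
  The \<open>m \<times> n \<times> 2\<close> tensor of indeterminates: the index ranges are the finite types \<open>'m\<close>, \<open>'n\<close>
  and \<open>2\<close>, whose two elements are \<open>1\<close> and \<open>2\<close>.  An \<open>m \<times> n\<close> matrix over \<open>R\<close> has type \<open>R^'n^'m\<close>.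
\<close>

type_synonym ('m, 'n, 'k) tensor_poly = "('m \<times> 'n \<times> 2, 'k) mpoly"

definition Xmat :: "('m, 'n, 'k::comm_ring_1) tensor_poly ^ 'n ^ 'm"
  where "Xmat = (\<chi> i j. Var (i, j, 1))"

definition Ymat :: "('m, 'n, 'k::comm_ring_1) tensor_poly ^ 'n ^ 'm"
  where "Ymat = (\<chi> i j. Var (i, j, 2))"

text \<open>The \<open>K\<close>-algebra endomorphism of \<open>K[T]\<close> that sends \<open>X\<close> to \<open>A\<close> and \<open>Y\<close> to \<open>B\<close> (entrywise).\<close>

definition slice_subst ::
  "('m, 'n, 'k) tensor_poly ^ 'n ^ 'm \<Rightarrow> ('m, 'n, 'k) tensor_poly ^ 'n ^ 'm \<Rightarrow>
   ('m, 'n, 'k) tensor_poly \<Rightarrow> ('m::finite, 'n::finite, 'k::comm_ring_1) tensor_poly"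
  where "slice_subst A B =
    poly_subst (\<lambda>(i, j, k). if k = 1 then A $ i $ j else B $ i $ j)"

definition SL :: "('k::field ^ 'n ^ 'n::finite) monoid"
  where "SL = \<lparr>carrier = {A. det A = 1}, mult = (**), one = mat 1\<rparr>"

definition act_G ::
  "('k ^ 'm ^ 'm) \<times> ('k ^ 'n ^ 'n) \<Rightarrow>
   ('m, 'n, 'k) tensor_poly \<Rightarrow> ('m::finite, 'n::finite, 'k::field) tensor_poly"
  where "act_G = (\<lambda>(P, Q).
    slice_subst (transpose (map_matrix Const P) ** Xmat ** map_matrix Const Q)
                (transpose (map_matrix Const P) ** Ymat ** map_matrix Const Q))"

definition act_SL2 ::
  "'k ^ 2 ^ 2 \<Rightarrow> ('m, 'n, 'k) tensor_poly \<Rightarrow> ('m::finite, 'n::finite, 'k::field) tensor_poly"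
  where "act_SL2 g =
    slice_subst (\<chi> i j. Const (g $ 1 $ 1) * Xmat $ i $ j + Const (g $ 2 $ 1) * Ymat $ i $ j)
                (\<chi> i j. Const (g $ 1 $ 2) * Xmat $ i $ j + Const (g $ 2 $ 2) * Ymat $ i $ j)"

definition act_G_SL2 ::
  "(('k ^ 'm ^ 'm) \<times> ('k ^ 'n ^ 'n)) \<times> ('k ^ 2 ^ 2) \<Rightarrow>
   ('m, 'n, 'k) tensor_poly \<Rightarrow> ('m::finite, 'n::finite, 'k::field) tensor_poly"
  where "act_G_SL2 = (\<lambda>(h, g). act_G h \<circ> act_SL2 g)"

definition invariant_ring :: "('g, 'x) monoid_scheme \<Rightarrow> ('g \<Rightarrow> 'r \<Rightarrow> 'r) \<Rightarrow> 'r set"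
  where "invariant_ring H \<phi> = {f. \<forall>h\<in>carrier H. \<phi> h f = f}"


section \<open>Substitution is a homomorphism of algebras\<close>

lemma Const_0 [simp]: "Const 0 = 0"
  and Const_1 [simp]: "Const 1 = 1"
  and Const_add: "Const (a + b) = Const a + Const b"
  and Const_mult: "Const (a * b) = Const a * Const b"
  by (simp_all add: Const_def single_add mult_single)

lemma Const_sum: "Const (sum f A) = (\<Sum>x\<in>A. Const (f x))"
  by (induction A rule: infinite_finite_induct) (simp_all add: Const_add)

definition mono_subst :: "('v \<Rightarrow> 'r::comm_ring_1) \<Rightarrow> ('v \<Rightarrow>\<^sub>0 nat) \<Rightarrow> 'r"
  where "mono_subst \<sigma> u = (\<Prod>v\<in>Poly_Mapping.keys u. \<sigma> v ^ Poly_Mapping.lookup u v)"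

lemma mono_subst_superset:
  assumes "finite A" "Poly_Mapping.keys u \<subseteq> A"
  shows "mono_subst \<sigma> u = (\<Prod>v\<in>A. \<sigma> v ^ Poly_Mapping.lookup u v)"
  unfolding mono_subst_def
  by (rule prod.mono_neutral_left) (use assms in \<open>auto simp: in_keys_iff\<close>)

lemma mono_subst_0 [simp]: "mono_subst \<sigma> 0 = 1"
  by (simp add: mono_subst_def)

lemma mono_subst_add: "mono_subst \<sigma> (u + w) = mono_subst \<sigma> u * mono_subst \<sigma> w"
proof -
  let ?A = "Poly_Mapping.keys u \<union> Poly_Mapping.keys w"
  have "mono_subst \<sigma> (u + w) = (\<Prod>v\<in>?A. \<sigma> v ^ Poly_Mapping.lookup (u + w) v)"
    by (rule mono_subst_superset) (use keys_add[of u w] in auto)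
  also have "\<dots> = (\<Prod>v\<in>?A. \<sigma> v ^ Poly_Mapping.lookup u v) * (\<Prod>v\<in>?A. \<sigma> v ^ Poly_Mapping.lookup w v)"
    by (simp add: lookup_add power_add prod.distrib)
  also have "\<dots> = mono_subst \<sigma> u * mono_subst \<sigma> w"
    by (subst (1 2) mono_subst_superset[of ?A]) auto
  finally show ?thesis .
qed

lemma poly_subst_superset:
  assumes "finite A" "Poly_Mapping.keys f \<subseteq> A"
  shows "poly_subst \<sigma> f = (\<Sum>u\<in>A. Const (Poly_Mapping.lookup f u) * mono_subst \<sigma> u)"
  unfolding poly_subst_def mono_subst_def
  by (rule sum.mono_neutral_left) (use assms in \<open>auto simp: in_keys_iff\<close>)

lemma poly_subst_single: "poly_subst \<sigma> (Poly_Mapping.single u c) = Const c * mono_subst \<sigma> u"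
  by (subst poly_subst_superset[of "{u}"]) auto

lemma poly_subst_Const [simp]: "poly_subst \<sigma> (Const c) = Const c"
  unfolding Const_def[of c] poly_subst_single by (simp add: Const_def)

lemma poly_subst_0 [simp]: "poly_subst \<sigma> 0 = 0"
  and poly_subst_1 [simp]: "poly_subst \<sigma> 1 = 1"
  using poly_subst_Const[of \<sigma> 0] poly_subst_Const[of \<sigma> 1] by simp_all

lemma poly_subst_Var [simp]: "poly_subst \<sigma> (Var v) = \<sigma> v"
  by (simp add: Var_def poly_subst_single mono_subst_def)

lemma poly_subst_add: "poly_subst \<sigma> (f + g) = poly_subst \<sigma> f + poly_subst \<sigma> g"
proof -
  let ?A = "Poly_Mapping.keys f \<union> Poly_Mapping.keys g"
  have *: "finite ?A" "Poly_Mapping.keys f \<subseteq> ?A" "Poly_Mapping.keys g \<subseteq> ?A"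
    "Poly_Mapping.keys (f + g) \<subseteq> ?A"
    using keys_add[of f g] by auto
  show ?thesis
    unfolding poly_subst_superset[OF *(1,2)] poly_subst_superset[OF *(1,3)]
      poly_subst_superset[OF *(1,4)]
    by (simp add: lookup_add Const_add distrib_right sum.distrib)
qed

lemma poly_subst_sum: "poly_subst \<sigma> (sum F A) = (\<Sum>x\<in>A. poly_subst \<sigma> (F x))"
  by (induction A rule: infinite_finite_induct) (simp_all add: poly_subst_add)

lemma poly_mapping_expand:
  fixes f :: "'u \<Rightarrow>\<^sub>0 'k::comm_monoid_add"
  shows "f = (\<Sum>u\<in>Poly_Mapping.keys f. Poly_Mapping.single u (Poly_Mapping.lookup f u))"
  by (rule poly_mapping_eqI)
     (auto simp: lookup_sum lookup_single when_def in_keys_iff)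

lemma poly_subst_mult: "poly_subst \<sigma> (f * g) = poly_subst \<sigma> f * poly_subst \<sigma> g"
proof -
  let ?s = "\<lambda>f u. Poly_Mapping.single u (Poly_Mapping.lookup f u)"
  have single: "poly_subst \<sigma> (Poly_Mapping.single u a * Poly_Mapping.single w b) =
      poly_subst \<sigma> (Poly_Mapping.single u a) * poly_subst \<sigma> (Poly_Mapping.single w b)" for u w a b
    by (simp add: mult_single poly_subst_single Const_mult mono_subst_add)
  have "poly_subst \<sigma> (sum (?s f) A * sum (?s g) B) =
      poly_subst \<sigma> (sum (?s f) A) * poly_subst \<sigma> (sum (?s g) B)" for A B
    by (simp add: sum_product poly_subst_sum single)
  from this[of "Poly_Mapping.keys f" "Poly_Mapping.keys g"] show ?thesis
    by (simp flip: poly_mapping_expand)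
qed

lemma poly_subst_power: "poly_subst \<sigma> (f ^ n) = poly_subst \<sigma> f ^ n"
  by (induction n) (simp_all add: poly_subst_mult)

lemma poly_subst_prod: "poly_subst \<sigma> (prod F A) = (\<Prod>x\<in>A. poly_subst \<sigma> (F x))"
  by (induction A rule: infinite_finite_induct) (simp_all add: poly_subst_mult)

lemma poly_subst_poly_subst:
  "poly_subst \<sigma> (poly_subst \<tau> f) = poly_subst (\<lambda>v. poly_subst \<sigma> (\<tau> v)) f"
  unfolding poly_subst_def[of \<tau>] poly_subst_def[of "\<lambda>v. poly_subst \<sigma> (\<tau> v)"]
  by (simp add: poly_subst_sum poly_subst_mult poly_subst_prod poly_subst_power)

lemma poly_subst_Var_id: "poly_subst Var f = f"
proof -
  have power: "(Var v :: ('a, 'b) mpoly) ^ n = Poly_Mapping.single (Poly_Mapping.single v n) 1"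
    for v and n
    by (induction n) (simp_all add: Var_def mult_single flip: single_add)
  have prod: "(\<Prod>x\<in>A. Poly_Mapping.single (h x) 1) = Poly_Mapping.single (\<Sum>x\<in>A. h x) (1 :: 'b)"
    for A and h :: "'a \<Rightarrow> 'a \<Rightarrow>\<^sub>0 nat"
    by (induction A rule: infinite_finite_induct) (simp_all add: mult_single)
  have "mono_subst Var u = Poly_Mapping.single u (1 :: 'b)" for u :: "'a \<Rightarrow>\<^sub>0 nat"
    by (simp add: mono_subst_def power prod flip: poly_mapping_expand)
  then have "poly_subst Var f =
      (\<Sum>u\<in>Poly_Mapping.keys f. Poly_Mapping.single u (Poly_Mapping.lookup f u))"
    by (subst poly_subst_superset[of "Poly_Mapping.keys f"]) (simp_all add: Const_def mult_single)
  then show ?thesis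
    by (simp flip: poly_mapping_expand)
qed


section \<open>The maps above are actions by algebra automorphisms\<close>

lemma slice_subst_Const [simp]: "slice_subst A B (Const c) = Const c"
  and slice_subst_add: "slice_subst A B (f + g) = slice_subst A B f + slice_subst A B g"
  and slice_subst_mult: "slice_subst A B (f * g) = slice_subst A B f * slice_subst A B g"
  and slice_subst_sum: "slice_subst A B (sum F S) = (\<Sum>x\<in>S. slice_subst A B (F x))"
  by (simp_all add: slice_subst_def poly_subst_add poly_subst_mult poly_subst_sum)

lemma map_matrix_slice_subst [simp]:
  "map_matrix (slice_subst A B) Xmat = A"
  "map_matrix (slice_subst A B) Ymat = B"
  by (simp_all add: vec_eq_iff Xmat_def Ymat_def slice_subst_def)

lemma map_matrix_slice_subst_Const [simp]:
  "map_matrix (slice_subst A B) (map_matrix Const M) = map_matrix Const M"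
  by (simp add: vec_eq_iff)

lemma map_matrix_slice_subst_mult:
  "map_matrix (slice_subst A B) (M ** N) =
    map_matrix (slice_subst A B) M ** map_matrix (slice_subst A B) N"
  by (simp add: vec_eq_iff matrix_matrix_mult_def slice_subst_sum slice_subst_mult)

lemma map_matrix_transpose: "map_matrix h (transpose M) = transpose (map_matrix h M)"
  by (simp add: vec_eq_iff transpose_def)

lemma map_matrix_Const_mult:
  "map_matrix Const (M ** N) = map_matrix Const M ** map_matrix Const N"
  by (simp add: vec_eq_iff matrix_matrix_mult_def Const_sum Const_mult)

lemma map_matrix_Const_1 [simp]: "map_matrix Const (mat 1) = mat 1"
  by (simp add: vec_eq_iff mat_def)

lemma slice_subst_slice_subst:
  "slice_subst A B (slice_subst C D f) =
    slice_subst (map_matrix (slice_subst A B) C) (map_matrix (slice_subst A B) D) f"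
  unfolding slice_subst_def poly_subst_poly_subst
  by (rule arg_cong[where f = "\<lambda>\<sigma>. poly_subst \<sigma> f"]) auto

lemma slice_subst_id [simp]: "slice_subst Xmat Ymat f = f"
proof -
  have two: "k = 1 \<or> k = 2" for k :: 2
    by (rule exhaust_2)
  have "slice_subst Xmat Ymat f = poly_subst Var f"
    unfolding slice_subst_def
    by (rule arg_cong[where f = "\<lambda>\<sigma>. poly_subst \<sigma> f"])
       (use two in \<open>fastforce simp: fun_eq_iff Xmat_def Ymat_def\<close>)
  then show ?thesis
    by (simp add: poly_subst_Var_id)
qed

lemma act_G_Xmat: "map_matrix (act_G (P, Q)) Xmat =
    transpose (map_matrix Const P) ** Xmat ** map_matrix Const Q"
  and act_G_Ymat: "map_matrix (act_G (P, Q)) Ymat =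
    transpose (map_matrix Const P) ** Ymat ** map_matrix Const Q"
  by (simp_all add: act_G_def)

lemma act_SL2_Xmat: "act_SL2 g (Xmat $ i $ j) =
    Const (g $ 1 $ 1) * Xmat $ i $ j + Const (g $ 2 $ 1) * Ymat $ i $ j"
  and act_SL2_Ymat: "act_SL2 g (Ymat $ i $ j) =
    Const (g $ 1 $ 2) * Xmat $ i $ j + Const (g $ 2 $ 2) * Ymat $ i $ j"
  by (simp_all add: act_SL2_def slice_subst_def Xmat_def Ymat_def)

lemma group_SL: "group (SL :: ('k::field ^ 'n ^ 'n::finite) monoid)"
proof (rule groupI)
  fix A :: "'k ^ 'n ^ 'n" assume "A \<in> carrier SL"
  then have A: "det A = 1" by (simp add: SL_def)
  then obtain B where B: "B ** A = mat 1"
    by (metis invertible_def invertible_det_nz zero_neq_one)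
  then have "det B = 1"
    using A det_mul[of B A] by simp
  with B show "\<exists>B\<in>carrier SL. B \<otimes>\<^bsub>SL\<^esub> A = \<one>\<^bsub>SL\<^esub>"
    by (auto simp: SL_def)
qed (auto simp: SL_def det_mul matrix_mul_assoc)

lemma act_G_one: "act_G (mat 1, mat 1) f = f"
  by (simp add: act_G_def)

lemma act_G_mult: "act_G (P ** P', Q ** Q') f = act_G (P, Q) (act_G (P', Q') f)"
  by (simp add: act_G_def slice_subst_slice_subst map_matrix_slice_subst_mult map_matrix_transpose
      map_matrix_Const_mult matrix_transpose_mul matrix_mul_assoc)

lemma act_SL2_one: "act_SL2 (mat 1) f = f"
proof -
  have "act_SL2 (mat 1) f = slice_subst (\<chi> i j. Xmat $ i $ j) (\<chi> i j. Ymat $ i $ j) f"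
    by (simp add: act_SL2_def mat_def)
  then show ?thesis
    by (simp add: vec_lambda_eta)
qed

lemma act_SL2_mult: "act_SL2 (g ** g') f = act_SL2 g (act_SL2 g' f)"
proof -
  let ?s = "slice_subst
    (\<chi> i j. Const (g $ 1 $ 1) * Xmat $ i $ j + Const (g $ 2 $ 1) * Ymat $ i $ j)
    (\<chi> i j. Const (g $ 1 $ 2) * Xmat $ i $ j + Const (g $ 2 $ 2) * Ymat $ i $ j)"
  have s: "?s (Xmat $ i $ j) = Const (g $ 1 $ 1) * Xmat $ i $ j + Const (g $ 2 $ 1) * Ymat $ i $ j"
    "?s (Ymat $ i $ j) = Const (g $ 1 $ 2) * Xmat $ i $ j + Const (g $ 2 $ 2) * Ymat $ i $ j" for i j
    using act_SL2_Xmat[of g i j] act_SL2_Ymat[of g i j] by (simp_all add: act_SL2_def)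
  show ?thesis
    unfolding act_SL2_def slice_subst_slice_subst
    by (rule arg_cong2[where f = "\<lambda>A B. slice_subst A B f"])
      (simp_all add: vec_eq_iff slice_subst_add slice_subst_mult s matrix_matrix_mult_def sum_2
        Const_add Const_mult, simp_all add: algebra_simps)
qed

lemma group_action_UNIV:
  assumes "group H"
    and one: "\<And>x. \<phi> \<one>\<^bsub>H\<^esub> x = x"
    and mult: "\<And>g h x. g \<in> carrier H \<Longrightarrow> h \<in> carrier H \<Longrightarrow> \<phi> (g \<otimes>\<^bsub>H\<^esub> h) x = \<phi> g (\<phi> h x)"
  shows "group_action H UNIV \<phi>"
proof -
  interpret group H by fact
  have bij: "bij (\<phi> g)" if "g \<in> carrier H" for g
    by (rule bij_betw_byWitness[where f' = "\<phi> (inv\<^bsub>H\<^esub> g)"])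
       (use that in \<open>auto simp flip: mult simp: one\<close>)
  have Bij: "\<phi> g \<in> Bij UNIV" if "g \<in> carrier H" for g
    using bij[OF that] by (simp add: Bij_def)
  show ?thesis
    by (intro group_action.intro group_hom.intro group_hom_axioms.intro homI)
       (auto simp: group_BijGroup is_group, auto simp: BijGroup_def Bij mult compose_def fun_eq_iff)
qed

lemma group_action_act_G:
  "group_action (SL \<times>\<times> SL) UNIV
    (act_G :: ('k::field ^ 'm ^ 'm) \<times> ('k ^ 'n ^ 'n) \<Rightarrow>
      ('m::finite, 'n::finite, 'k) tensor_poly \<Rightarrow> _)"
  by (rule group_action_UNIV)
     (auto simp: DirProd_group group_SL, auto simp: SL_def act_G_one act_G_mult)

lemma group_action_act_SL2:
  "group_action SL UNIV
    (act_SL2 :: ('k::field ^ 2 ^ 2) \<Rightarrow> ('m::finite, 'n::finite, 'k) tensor_poly \<Rightarrow> _)"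
  by (rule group_action_UNIV)
     (auto simp: group_SL, auto simp: SL_def act_SL2_one act_SL2_mult)

end

theory Submission
  imports Defs "Jordan_Normal_Form.Char_Poly"
begin

hide_const (open) Determinants.det

text \<open>
  Over an infinite field it suffices to compare values at points, and \<open>SL(2, K)\<close> is generated by
  transvections, so the task is to show \<open>f(X + cY, Y) = f(X, Y)\<close> for every \<open>G\<close>-invariant \<open>f\<close>.
  Since \<open>m < n\<close>, a generic \<open>Y\<close> can be moved by \<open>SL(n, K)\<close> to \<open>(1, 0)\<close>.  With \<open>X = (A, B)\<close> the
  stabilizer of this \<open>Y\<close> acts on the pair \<open>(A, B)\<close> like feedback, \<open>A \<mapsto> A + BR\<close>, and changes of
  bases act on the linear system \<open>x' = Ax + Bu\<close>; the claim becomes \<open>F(A + c, B) = F(A, B)\<close>.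
  If \<open>B\<close> is onto, feedback undoes the shift by \<open>c\<close>.  Otherwise a generic \<open>B\<close> is moved to the transpose
  of \<open>(1, 0)\<close>, feedback erases the top rows of \<open>A\<close>, and the bottom rows \<open>(A21, A22)\<close> form a smaller
  system \<open>(A22, A21)\<close> with the same symmetries, on which the shift acts in the same way.
  The descent replaces an \<open>m \<times> (m + r)\<close> pencil by an \<open>(m - r) \<times> m\<close> pencil.
\<close>


section \<open>Generic matrices and block matrices\<close>

lemma poly_eqI_cofinite:
  fixes p q :: "'a::field poly"
  assumes "infinite (UNIV :: 'a set)" "finite E" "\<And>t. t \<notin> E \<Longrightarrow> poly p t = poly q t"
  shows "p = q"
proof (rule ccontr)
  assume "p \<noteq> q"
  then have "finite {t. poly (p - q) t = 0}"
    by (intro poly_roots_finite) auto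
  \<comment> \<open>Otherwise the infinite field would be covered by \<open>E\<close> and the
    finitely many roots of \<open>p - q\<close>.\<close>
  moreover have "UNIV = E \<union> {t. poly (p - q) t = 0}"
    using assms(3) by auto
  ultimately show False
    using assms(1,2) by (metis finite_Un)
qed

text \<open>Up to sign these \<open>t\<close> are roots of the characteristic polynomial, which is
  monic and hence nonzero. So a square block becomes invertible after a generic shift along the
  identity.\<close>

lemma finite_singular_shifts:
  fixes M :: "'a::field mat"
  assumes M: "M \<in> carrier_mat n n"
  shows "finite {t. det (M + t \<cdot>\<^sub>m 1\<^sub>m n) = 0}"
proof -
  have "{t. det (M + t \<cdot>\<^sub>m 1\<^sub>m n) = 0} \<subseteq> uminus ` {t. poly (char_poly M) t = 0}"
  proof
    fix t assume "t \<in> {t. det (M + t \<cdot>\<^sub>m 1\<^sub>m n) = 0}"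
    moreover have "char_matrix M (- t) = M + t \<cdot>\<^sub>m 1\<^sub>m n"
      using M by (auto simp: char_matrix_def)
    ultimately have "poly (char_poly M) (- t) = 0"
      using eigenvalue_det[OF M, of "- t"] eigenvalue_root_char_poly[OF M, of "- t"] by simp
    then show "t \<in> uminus ` {t. poly (char_poly M) t = 0}"
      by (intro image_eqI[of _ _ "- t"]) auto
  qed
  moreover have "char_poly M \<noteq> 0"
    using degree_monic_char_poly[OF M] by auto
  ultimately show ?thesis
    using poly_roots_finite finite_subset by blast
qed

lemma obtain_inverse_mat:
  fixes M :: "'a::field mat"
  assumes M: "M \<in> carrier_mat n n" and "det M \<noteq> 0"
  obtains M' where "M' \<in> carrier_mat n n" "M * M' = 1\<^sub>m n" "M' * M = 1\<^sub>m n" "det M' = inverse (det M)"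
proof -
  \<comment> \<open>The argument \<open>()\<close> only fills the extension slot of the matrix ring
    record.\<close>
  from det_non_zero_imp_unit[OF assms, of "()"]
  obtain M' where M': "M' \<in> carrier_mat n n" "M * M' = 1\<^sub>m n" "M' * M = 1\<^sub>m n"
    by (auto simp: Units_def ring_mat_def)
  have "det M * det M' = 1"
    using det_mult[OF M M'(1)] M'(2) by simp
  then have "det M' = inverse (det M)"
    using inverse_unique by metis
  with M' show ?thesis by (rule that)
qed

section \<open>Block rows and block columns\<close>

definition hcat :: "'a::zero mat \<Rightarrow> 'a mat \<Rightarrow> 'a mat" where
  "hcat A B = four_block_mat A B (0\<^sub>m 0 (dim_col A)) (0\<^sub>m 0 (dim_col B))"

definition vcat :: "'a::zero mat \<Rightarrow> 'a mat \<Rightarrow> 'a mat" where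
  "vcat A B = four_block_mat A (0\<^sub>m (dim_row A) 0) B (0\<^sub>m (dim_row B) 0)"

lemma hcat_carrier [intro, simp]:
  "A \<in> carrier_mat m n \<Longrightarrow> B \<in> carrier_mat m k \<Longrightarrow> hcat A B \<in> carrier_mat m (n + k)"
  by (auto simp: hcat_def)

lemma vcat_carrier [intro, simp]:
  "A \<in> carrier_mat m n \<Longrightarrow> B \<in> carrier_mat k n \<Longrightarrow> vcat A B \<in> carrier_mat (m + k) n"
  by (auto simp: vcat_def)

lemma transpose_hcat:
  "A \<in> carrier_mat m n \<Longrightarrow> B \<in> carrier_mat m k \<Longrightarrow>
    transpose_mat (hcat A B) = vcat (transpose_mat A) (transpose_mat B)"
  by (auto simp: hcat_def vcat_def transpose_four_block_mat)

lemma hcat_cases: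
  assumes "Z \<in> carrier_mat m (n + k)"
  obtains A B where "A \<in> carrier_mat m n" "B \<in> carrier_mat m k" "Z = hcat A B"
proof -
  obtain A B C D where s: "split_block Z m n = (A, B, C, D)"
    by (metis prod_cases4)
  have d: "dim_row Z = m + 0" "dim_col Z = n + k"
    using assms by auto
  note sb = split_block[OF s d]
  moreover have "C = 0\<^sub>m 0 n" "D = 0\<^sub>m 0 k"
    using sb by auto
  ultimately show ?thesis
    using that[of A B] by (auto simp: hcat_def)
qed

lemma vcat_cases:
  assumes "Z \<in> carrier_mat (n + k) m"
  obtains A B where "A \<in> carrier_mat n m" "B \<in> carrier_mat k m" "Z = vcat A B"
proof -
  obtain A B C D where s: "split_block Z n m = (A, B, C, D)"
    by (metis prod_cases4)
  have d: "dim_row Z = n + k" "dim_col Z = m + 0"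
    using assms by auto
  note sb = split_block[OF s d]
  moreover have "B = 0\<^sub>m n 0" "D = 0\<^sub>m k 0"
    using sb by auto
  ultimately show ?thesis
    using that[of A C] by (auto simp: vcat_def)
qed

lemma four_block_cases:
  assumes "Z \<in> carrier_mat (n + k) (n' + k')"
  obtains A B C D where "A \<in> carrier_mat n n'" "B \<in> carrier_mat n k'"
    "C \<in> carrier_mat k n'" "D \<in> carrier_mat k k'" "Z = four_block_mat A B C D"
proof -
  obtain A B C D where s: "split_block Z n n' = (A, B, C, D)"
    by (metis prod_cases4)
  have d: "dim_row Z = n + k" "dim_col Z = n' + k'"
    using assms by auto
  from split_block[OF s d] show ?thesis
    by (rule that)
qed

text \<open>The blocks of height or width zero in \<open>hcat\<close>, in \<open>vcat\<close> and in
  the padded \<open>P\<close> here reduce the product to the rule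
  \<open>mult_four_block_mat\<close>.\<close>

lemma mult_hcat:
  fixes P :: "'a::comm_ring_1 mat"
  assumes "P \<in> carrier_mat l m" "A \<in> carrier_mat m n" "B \<in> carrier_mat m k"
  shows "P * hcat A B = hcat (P * A) (P * B)"
proof -
  have "four_block_mat P (0\<^sub>m l 0) (0\<^sub>m 0 m) (0\<^sub>m 0 0) = P"
    using assms by (auto intro!: eq_matI)
  moreover have "four_block_mat P (0\<^sub>m l 0) (0\<^sub>m 0 m) (0\<^sub>m 0 0) * four_block_mat A B (0\<^sub>m 0 n) (0\<^sub>m 0 k)
      = four_block_mat (P * A) (P * B) (0\<^sub>m 0 n) (0\<^sub>m 0 k)"
    using assms by (subst mult_four_block_mat) (auto intro!: cong_four_block_mat)
  ultimately show ?thesis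
    using assms by (auto simp: hcat_def)
qed

lemma hcat_mult_four_block:
  fixes A :: "'a::comm_ring_1 mat"
  assumes "A \<in> carrier_mat l m" "B \<in> carrier_mat l n"
    "C \<in> carrier_mat m j" "D \<in> carrier_mat m k" "E \<in> carrier_mat n j" "G \<in> carrier_mat n k"
  shows "hcat A B * four_block_mat C D E G = hcat (A * C + B * E) (A * D + B * G)"
  unfolding hcat_def using assms
  by (subst mult_four_block_mat) (auto intro!: cong_four_block_mat)

lemma four_block_mult_vcat:
  fixes A :: "'a::comm_ring_1 mat"
  assumes "A \<in> carrier_mat i m" "B \<in> carrier_mat i n" "C \<in> carrier_mat j m" "D \<in> carrier_mat j n"
    "M \<in> carrier_mat m k" "N \<in> carrier_mat n k"
  shows "four_block_mat A B C D * vcat M N = vcat (A * M + B * N) (C * M + D * N)"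
  unfolding vcat_def using assms
  by (subst mult_four_block_mat) (auto intro!: cong_four_block_mat)

lemma vcat_mult:
  fixes M :: "'a::comm_ring_1 mat"
  assumes "M \<in> carrier_mat m l" "N \<in> carrier_mat n l" "R \<in> carrier_mat l k"
  shows "vcat M N * R = vcat (M * R) (N * R)"
proof -
  have "four_block_mat R (0\<^sub>m l 0) (0\<^sub>m 0 k) (0\<^sub>m 0 0) = R"
    using assms by (auto intro!: eq_matI)
  moreover have "four_block_mat M (0\<^sub>m m 0) N (0\<^sub>m n 0) * four_block_mat R (0\<^sub>m l 0) (0\<^sub>m 0 k) (0\<^sub>m 0 0)
      = four_block_mat (M * R) (0\<^sub>m m 0) (N * R) (0\<^sub>m n 0)"
    using assms by (subst mult_four_block_mat) (auto intro!: cong_four_block_mat)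
  ultimately show ?thesis
    using assms by (auto simp: vcat_def)
qed

lemma vcat_mult_hcat:
  fixes M :: "'a::comm_ring_1 mat"
  assumes "M \<in> carrier_mat m l" "N \<in> carrier_mat n l" "R \<in> carrier_mat l k" "S \<in> carrier_mat l j"
  shows "vcat M N * hcat R S = four_block_mat (M * R) (M * S) (N * R) (N * S)"
  unfolding vcat_def hcat_def using assms
  by (subst mult_four_block_mat) (auto intro!: cong_four_block_mat)

lemma hcat_mult_vcat:
  fixes A :: "'a::comm_ring_1 mat"
  assumes "A \<in> carrier_mat l m" "B \<in> carrier_mat l n" "M \<in> carrier_mat m k" "N \<in> carrier_mat n k"
  shows "hcat A B * vcat M N = A * M + B * N"
proof -
  have "hcat A B * vcat M N = four_block_mat (A * M + B * N) (0\<^sub>m l 0) (0\<^sub>m 0 k) (0\<^sub>m 0 0)"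
    unfolding vcat_def hcat_def using assms
    by (subst mult_four_block_mat) (auto intro!: cong_four_block_mat)
  also have "\<dots> = A * M + B * N"
    using assms by (auto intro!: eq_matI)
  finally show ?thesis .
qed

lemma uminus_r_inv_mat:
  fixes A :: "'a::group_add mat"
  shows "A \<in> carrier_mat m n \<Longrightarrow> A + - A = 0\<^sub>m m n"
  by (intro eq_matI) auto

lemma four_block_add_smult:
  assumes "A \<in> carrier_mat m n" "B \<in> carrier_mat m l" "C \<in> carrier_mat k n" "D \<in> carrier_mat k l"
    and "A' \<in> carrier_mat m n" "B' \<in> carrier_mat m l" "C' \<in> carrier_mat k n" "D' \<in> carrier_mat k l"
  shows "four_block_mat A B C D + t \<cdot>\<^sub>m four_block_mat A' B' C' D' =
    four_block_mat (A + t \<cdot>\<^sub>m A') (B + t \<cdot>\<^sub>m B') (C + t \<cdot>\<^sub>m C') (D + t \<cdot>\<^sub>m D')"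
  using assms
  by (simp add: smult_four_block_mat[of _ m n _ l _ k] add_four_block_mat[of _ m n _ l _ k])

lemma hcat_add_smult:
  fixes A :: "'a::comm_ring_1 mat"
  assumes "A \<in> carrier_mat m n" "B \<in> carrier_mat m k" "A' \<in> carrier_mat m n" "B' \<in> carrier_mat m k"
  shows "hcat A B + t \<cdot>\<^sub>m hcat A' B' = hcat (A + t \<cdot>\<^sub>m A') (B + t \<cdot>\<^sub>m B')"
  using assms by (simp add: hcat_def four_block_add_smult[of _ m n _ k _ 0])

lemma vcat_add_smult:
  fixes A :: "'a::comm_ring_1 mat"
  assumes "A \<in> carrier_mat n m" "B \<in> carrier_mat k m" "A' \<in> carrier_mat n m" "B' \<in> carrier_mat k m"
  shows "vcat A B + t \<cdot>\<^sub>m vcat A' B' = vcat (A + t \<cdot>\<^sub>m A') (B + t \<cdot>\<^sub>m B')"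
  using assms by (simp add: vcat_def four_block_add_smult[of _ n m _ 0 _ k])

section \<open>Normal forms under the special linear group\<close>

lemma ex_mat_det:
  assumes "0 < k"
  shows "\<exists>D \<in> carrier_mat k k. det D = (d::'a::field)"
proof -
  obtain l where k: "k = 1 + l"
    using assms by (metis Suc_leI One_nat_def le_Suc_ex)
  \<comment> \<open>The witness is the diagonal matrix with entries \<open>d\<close>, 1, ..., 1; it
    needs \<open>0 < k\<close>, because the empty matrix has determinant 1.\<close>
  let ?D = "four_block_mat (d \<cdot>\<^sub>m 1\<^sub>m 1) (0\<^sub>m 1 l) (0\<^sub>m l 1) (1\<^sub>m l)"
  have "det ?D = det (d \<cdot>\<^sub>m 1\<^sub>m 1) * det (1\<^sub>m l :: 'a mat)"
    by (rule det_four_block_mat_lower_left_zero) auto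
  then have "det ?D = d"
    by (simp add: det_smult)
  then show ?thesis
    by (intro bexI[of _ ?D]) (auto simp: k)
qed

text \<open>The room in the last \<open>k\<close> columns absorbs the determinant, so no scalar is left over.\<close>

lemma sl_normalize_hcat:
  fixes M :: "'a::field mat"
  assumes M: "M \<in> carrier_mat n n" "det M \<noteq> 0" and N: "N \<in> carrier_mat n k" and "0 < k"
  obtains Q where "Q \<in> carrier_mat (n + k) (n + k)" "det Q = 1"
    "hcat M N * Q = hcat (1\<^sub>m n) (0\<^sub>m n k)"
proof -
  obtain M' where M': "M' \<in> carrier_mat n n" "M * M' = 1\<^sub>m n" "det M' = inverse (det M)"
    using obtain_inverse_mat[OF M] by metis
  obtain D where D: "D \<in> carrier_mat k k" "det D = det M"
    using ex_mat_det[OF \<open>0 < k\<close>, of "det M"] by auto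
  \<comment> \<open>The first block column turns \<open>M\<close> into the identity. The second
    clears \<open>N\<close>, since \<open>M * M' = 1\<close>, and \<open>det D = det M\<close>
    cancels \<open>det M'\<close>.\<close>
  let ?Q = "four_block_mat M' (- (M' * N * D)) (0\<^sub>m k n) D"
  have c: "M' * N * D \<in> carrier_mat n k" using M' N D by auto
  have "M * (- (M' * N * D)) = - (M * (M' * N * D))"
    using M c M' by (intro uminus_mult_right_mat) auto
  also have "M' * N * D = M' * (N * D)"
    using M' N D by (intro assoc_mult_mat) auto
  also have "M * (M' * (N * D)) = M * M' * (N * D)"
    using M M' N D by (intro assoc_mult_mat[symmetric]) auto
  finally have "M * (- (M' * N * D)) + N * D = 0\<^sub>m n k"
    using M' N D by (simp add: assoc_mult_mat[of _ n n _ k _ k])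
  then have "hcat M N * ?Q = hcat (1\<^sub>m n) (0\<^sub>m n k)"
    using M M' N D c by (subst hcat_mult_four_block) auto
  moreover have "det ?Q = det M' * det D"
    by (rule det_four_block_mat_lower_left_zero) (use M' D c in auto)
  ultimately show ?thesis
    using that[of ?Q] M M' D by auto
qed

text \<open>Transposition turns the column operations of \<open>sl_normalize_hcat\<close> into row
  operations.\<close>

lemma sl_normalize_vcat:
  fixes M :: "'a::field mat"
  assumes M: "M \<in> carrier_mat n n" "det M \<noteq> 0" and N: "N \<in> carrier_mat k n" and "0 < k"
  obtains P where "P \<in> carrier_mat (n + k) (n + k)" "det P = 1"
    "P * vcat M N = vcat (1\<^sub>m n) (0\<^sub>m k n)"
proof -
  obtain Q where Q: "Q \<in> carrier_mat (n + k) (n + k)" "det Q = 1"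
    "hcat (transpose_mat M) (transpose_mat N) * Q = hcat (1\<^sub>m n) (0\<^sub>m n k)"
    using sl_normalize_hcat[of "transpose_mat M" n "transpose_mat N" k] M N \<open>0 < k\<close>
    by (metis transpose_carrier_mat det_transpose)
  have "vcat (1\<^sub>m n) (0\<^sub>m k n) = transpose_mat (hcat (transpose_mat M) (transpose_mat N) * Q)"
    unfolding Q by (subst transpose_hcat) auto
  also have "\<dots> = transpose_mat Q * transpose_mat (hcat (transpose_mat M) (transpose_mat N))"
    using M N Q by (subst transpose_mult) auto
  also have "transpose_mat (hcat (transpose_mat M) (transpose_mat N)) = vcat M N"
    using M N by (subst transpose_hcat) auto
  finally show ?thesis
    using that[of "transpose_mat Q"] Q by (auto simp: det_transpose)
qed


section \<open>Linear systems up to feedback\<close>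

text \<open>For the system x' = Ax + Bu, \<open>R\<close> is a state feedback, \<open>S\<close> a
  change of input basis, and \<open>P\<close> a change of state basis with inverse
  \<open>P'\<close>. The two determinant conditions are separate, which is what the pencil
  symmetries provide and what the descent preserves.\<close>

definition feedback_invariant :: "nat \<Rightarrow> nat \<Rightarrow> ('a::field mat \<Rightarrow> 'a mat \<Rightarrow> 'a) \<Rightarrow> bool" where
  "feedback_invariant m r F \<longleftrightarrow>
    (\<forall>A \<in> carrier_mat m m. \<forall>B \<in> carrier_mat m r.
      (\<forall>R \<in> carrier_mat r m. F (A + B * R) B = F A B) \<and>
      (\<forall>S \<in> carrier_mat r r. det S = 1 \<longrightarrow> F A (B * S) = F A B) \<and>
      (\<forall>P \<in> carrier_mat m m. \<forall>P' \<in> carrier_mat m m. det P = 1 \<longrightarrow> P * P' = 1\<^sub>m m \<longrightarrow>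
        F (P * A * P') (P * B) = F A B))"

text \<open>Density arguments use only restrictions to lines, and in this form polynomiality passes
  to the functions obtained by fixing some blocks.\<close>

definition polynomial_on_lines ::
  "nat \<Rightarrow> nat \<Rightarrow> nat \<Rightarrow> nat \<Rightarrow> ('a::field mat \<Rightarrow> 'a mat \<Rightarrow> 'a) \<Rightarrow> bool" where
  "polynomial_on_lines m n k l F \<longleftrightarrow>
    (\<forall>A \<in> carrier_mat m n. \<forall>A' \<in> carrier_mat m n. \<forall>B \<in> carrier_mat k l. \<forall>B' \<in> carrier_mat k l.
      \<exists>p. \<forall>t. F (A + t \<cdot>\<^sub>m A') (B + t \<cdot>\<^sub>m B') = poly p t)"

lemma feedback_invariantD:
  assumes "feedback_invariant m r F" "A \<in> carrier_mat m m" "B \<in> carrier_mat m r"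
  shows "R \<in> carrier_mat r m \<Longrightarrow> F (A + B * R) B = F A B"
    and "S \<in> carrier_mat r r \<Longrightarrow> det S = 1 \<Longrightarrow> F A (B * S) = F A B"
    and "P \<in> carrier_mat m m \<Longrightarrow> P' \<in> carrier_mat m m \<Longrightarrow> det P = 1 \<Longrightarrow> P * P' = 1\<^sub>m m \<Longrightarrow>
      F (P * A * P') (P * B) = F A B"
  using assms unfolding feedback_invariant_def by blast+

lemma polynomial_on_linesD:
  assumes "polynomial_on_lines m n k l F"
    "A \<in> carrier_mat m n" "A' \<in> carrier_mat m n" "B \<in> carrier_mat k l" "B' \<in> carrier_mat k l"
  shows "\<exists>p. \<forall>t. F (A + t \<cdot>\<^sub>m A') (B + t \<cdot>\<^sub>m B') = poly p t"
  using assms unfolding polynomial_on_lines_def by blast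

text \<open>With the first arguments held fixed by a zero direction, both sides are polynomials in
  \<open>t\<close> along \<open>B + tJ\<close>. Agreement off \<open>E\<close> makes these
  polynomials equal, so \<open>t = 0\<close> may be inserted even if it lies in
  \<open>E\<close>.\<close>

lemma eq_if_eq_generic:
  fixes F :: "'a::field mat \<Rightarrow> 'a mat \<Rightarrow> 'a"
  assumes "infinite (UNIV :: 'a set)" and poly: "polynomial_on_lines m n k l F"
    and A: "A \<in> carrier_mat m n" "A' \<in> carrier_mat m n" and B: "B \<in> carrier_mat k l" "J \<in> carrier_mat k l"
    and E: "finite E" "\<And>t. t \<notin> E \<Longrightarrow> F A (B + t \<cdot>\<^sub>m J) = F A' (B + t \<cdot>\<^sub>m J)"
  shows "F A B = F A' B"
proof -
  have zero: "C + t \<cdot>\<^sub>m 0\<^sub>m m n = C" if "C \<in> carrier_mat m n" for C :: "'a mat" and t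
    using that by auto
  obtain p where p: "\<And>t. F A (B + t \<cdot>\<^sub>m J) = poly p t"
    using polynomial_on_linesD[OF poly A(1) zero_carrier_mat B] unfolding zero[OF A(1)] by auto
  obtain q where q: "\<And>t. F A' (B + t \<cdot>\<^sub>m J) = poly q t"
    using polynomial_on_linesD[OF poly A(2) zero_carrier_mat B] unfolding zero[OF A(2)] by auto
  have "p = q"
    using poly_eqI_cofinite[OF assms(1) E(1)] E(2) by (metis p q)
  moreover have "B + 0 \<cdot>\<^sub>m J = B"
    using B by auto
  ultimately show ?thesis
    by (metis p q)
qed

text \<open>With at least as many inputs as states, a generic \<open>B\<close> has an invertible
  leading block and therefore a right inverse, so some feedback cancels the shift.\<close>

lemma feedback_shift_wide:
  fixes F :: "'a::field mat \<Rightarrow> 'a mat \<Rightarrow> 'a"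
  assumes inf: "infinite (UNIV :: 'a set)" and F: "feedback_invariant m (m + k) F"
    and poly: "polynomial_on_lines m m m (m + k) F"
    and A: "A \<in> carrier_mat m m" and B: "B \<in> carrier_mat m (m + k)"
  shows "F (A + c \<cdot>\<^sub>m 1\<^sub>m m) B = F A B"
proof -
  obtain M N where MN: "M \<in> carrier_mat m m" "N \<in> carrier_mat m k" "B = hcat M N"
    using hcat_cases[OF B] .
  let ?J = "hcat (1\<^sub>m m) (0\<^sub>m m k)"
  show ?thesis
  proof (rule eq_if_eq_generic[OF inf poly _ A B])
    show "finite {t. det (M + t \<cdot>\<^sub>m 1\<^sub>m m) = 0}"
      using finite_singular_shifts MN(1) .
    fix t assume "t \<notin> {t. det (M + t \<cdot>\<^sub>m 1\<^sub>m m) = 0}"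
    then obtain M' where M': "M' \<in> carrier_mat m m" "(M + t \<cdot>\<^sub>m 1\<^sub>m m) * M' = 1\<^sub>m m"
      using obtain_inverse_mat[of "M + t \<cdot>\<^sub>m 1\<^sub>m m" m] MN(1) by auto
    have Bt: "B + t \<cdot>\<^sub>m ?J = hcat (M + t \<cdot>\<^sub>m 1\<^sub>m m) N"
      using MN by (simp add: hcat_add_smult[of _ m m _ k])
    \<comment> \<open>Only the inputs of the leading block are used, so that the perturbed input
      matrix times \<open>?R\<close> is \<open>-c\<close> times the identity.\<close>
    let ?R = "vcat (- c \<cdot>\<^sub>m M') (0\<^sub>m k m)"
    have "(M + t \<cdot>\<^sub>m 1\<^sub>m m) * (- c \<cdot>\<^sub>m M') = - c \<cdot>\<^sub>m 1\<^sub>m m"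
      using MN M' by (subst mult_smult_distrib[of _ m m _ m]) auto
    then have "(B + t \<cdot>\<^sub>m ?J) * ?R = - c \<cdot>\<^sub>m 1\<^sub>m m"
      using MN M' unfolding Bt by (subst hcat_mult_vcat) auto
    then have "A + c \<cdot>\<^sub>m 1\<^sub>m m + (B + t \<cdot>\<^sub>m ?J) * ?R = A"
      using A by auto
    then show "F (A + c \<cdot>\<^sub>m 1\<^sub>m m) (B + t \<cdot>\<^sub>m ?J) = F A (B + t \<cdot>\<^sub>m ?J)"
      using feedback_invariantD(1)[OF F, of "A + c \<cdot>\<^sub>m 1\<^sub>m m" "B + t \<cdot>\<^sub>m ?J" ?R] A MN M' by (auto simp: Bt)
  qed (use A in auto)
qed

text \<open>The lower rows of the state matrix are read as a system with \<open>k\<close> states and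
  \<open>r\<close> inputs: the lower right block \<open>A\<close> is its state matrix, and the lower
  left block \<open>B\<close>, the influence of the upper states, is its input matrix.\<close>

definition reduced_system :: "nat \<Rightarrow> nat \<Rightarrow> ('a::field mat \<Rightarrow> 'a mat \<Rightarrow> 'a) \<Rightarrow> 'a mat \<Rightarrow> 'a mat \<Rightarrow> 'a" where
  "reduced_system r k F A B =
    F (four_block_mat (0\<^sub>m r r) (0\<^sub>m r k) B A) (vcat (1\<^sub>m r) (0\<^sub>m k r))"

text \<open>When the input matrix is the identity on top of zero, feedback adds arbitrary rows to
  the top \<open>r\<close> rows and nothing elsewhere, so the top rows can be erased.\<close>

lemma reduced_system_eq:
  fixes F :: "'a::field mat \<Rightarrow> 'a mat \<Rightarrow> 'a"
  assumes F: "feedback_invariant (r + k) r F"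
    and A: "A \<in> carrier_mat r r" "B \<in> carrier_mat r k" "C \<in> carrier_mat k r" "D \<in> carrier_mat k k"
  shows "F (four_block_mat A B C D) (vcat (1\<^sub>m r) (0\<^sub>m k r)) = reduced_system r k F D C"
proof -
  let ?J = "vcat (1\<^sub>m r) (0\<^sub>m k r)" and ?R = "hcat (- A) (- B)"
  have "?J * ?R = four_block_mat (- A) (- B) (0\<^sub>m k r) (0\<^sub>m k k)"
    using A by (subst vcat_mult_hcat) auto
  then have "four_block_mat A B C D + ?J * ?R = four_block_mat (0\<^sub>m r r) (0\<^sub>m r k) C D"
    using A by (simp add: add_four_block_mat[of _ r r _ k _ k] uminus_r_inv_mat[of _ r r] uminus_r_inv_mat[of _ r k])
  then show ?thesis
    using feedback_invariantD(1)[OF F, of "four_block_mat A B C D" ?J ?R] A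
    by (auto simp: reduced_system_def)
qed

text \<open>Each symmetry of the small system lifts to a change of state basis of the large one. Its
  effects on the top rows and on \<open>?J\<close> are undone by feedback and by a change of input
  basis.\<close>

lemma reduced_system_invariant:
  fixes F :: "'a::field mat \<Rightarrow> 'a mat \<Rightarrow> 'a"
  assumes F: "feedback_invariant (r + k) r F"
  shows "feedback_invariant k r (reduced_system r k F)"
  unfolding feedback_invariant_def
proof (intro ballI conjI impI)
  fix A B :: "'a mat" assume A: "A \<in> carrier_mat k k" and B: "B \<in> carrier_mat k r"
  let ?J = "vcat (1\<^sub>m r) (0\<^sub>m k r) :: 'a mat"
  let ?A = "four_block_mat (0\<^sub>m r r) (0\<^sub>m r k) B A"
  have c: "?A \<in> carrier_mat (r + k) (r + k)" "?J \<in> carrier_mat (r + k) r"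
    using A B by auto
  note conj = feedback_invariantD(3)[OF F c]
  {
    fix R :: "'a mat" assume R: "R \<in> carrier_mat r k"
    \<comment> \<open>Feedback lifts to conjugation by a shear. The left factor fixes
      \<open>?J\<close> and disturbs only the top rows, the right factor adds \<open>B * R\<close>
      to \<open>A\<close>, and \<open>reduced_system_eq\<close> erases the top rows again.\<close>
    let ?P = "four_block_mat (1\<^sub>m r) (- R) (0\<^sub>m k r) (1\<^sub>m k)"
    let ?P' = "four_block_mat (1\<^sub>m r) R (0\<^sub>m k r) (1\<^sub>m k)"
    have "?P * ?P' = 1\<^sub>m (r + k)"
      using R by (subst mult_four_block_mat) (auto simp: uminus_r_inv_mat[of _ r k])
    moreover have "det ?P = 1"
      using R by (subst det_four_block_mat_lower_left_zero) auto
    moreover have "?P * ?J = ?J"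
      using R by (subst four_block_mult_vcat) auto
    moreover have "?P * ?A = four_block_mat (- R * B) (- R * A) B A"
      using R A B by (subst mult_four_block_mat) auto
    moreover have "four_block_mat (- R * B) (- R * A) B A * ?P' =
        four_block_mat (- R * B) (- R * B * R + - R * A) B (B * R + A)"
      using R A B by (subst mult_four_block_mat) auto
    ultimately have "reduced_system r k F A B =
        F (four_block_mat (- R * B) (- R * B * R + - R * A) B (B * R + A)) ?J"
      using conj[of ?P ?P'] R by (auto simp: reduced_system_def)
    also have "\<dots> = reduced_system r k F (B * R + A) B"
      using R A B by (intro reduced_system_eq[OF F]) auto
    also have "B * R + A = A + B * R"
      using R A B by (auto intro: comm_add_mat)
    finally show "reduced_system r k F (A + B * R) B = reduced_system r k F A B" ..
  next
    fix S :: "'a mat" assume S: "S \<in> carrier_mat r r" "det S = 1"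
    then obtain S' where S': "S' \<in> carrier_mat r r" "S' * S = 1\<^sub>m r" "det S' = 1"
      using obtain_inverse_mat[of S r] by auto
    \<comment> \<open>A new input basis of the small system is a new basis of the upper states of
      the large one. This turns \<open>?J\<close> into \<open>?J * S'\<close>, and the large system
      may drop the factor \<open>S'\<close> of determinant one.\<close>
    let ?P = "four_block_mat S' (0\<^sub>m r k) (0\<^sub>m k r) (1\<^sub>m k)"
    let ?P' = "four_block_mat S (0\<^sub>m r k) (0\<^sub>m k r) (1\<^sub>m k)"
    let ?A' = "four_block_mat (0\<^sub>m r r) (0\<^sub>m r k) (B * S) A"
    have "?P * ?P' = 1\<^sub>m (r + k)"
      using S S' by (subst mult_four_block_mat) auto
    moreover have "det ?P = 1"
      using S' by (subst det_four_block_mat_lower_left_zero) auto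
    moreover have "?P * ?J = ?J * S'"
      using S' by (subst four_block_mult_vcat, auto, subst vcat_mult) auto
    moreover have "?P * ?A = ?A"
      using S' A B by (subst mult_four_block_mat) auto
    moreover have "?A * ?P' = ?A'"
      using S A B by (subst mult_four_block_mat) auto
    ultimately have "reduced_system r k F A B = F ?A' (?J * S')"
      using conj[of ?P ?P'] S S' by (auto simp: reduced_system_def)
    also have "\<dots> = F ?A' ?J"
      using feedback_invariantD(2)[OF F, of ?A' ?J S'] S S' A B by auto
    finally show "reduced_system r k F A (B * S) = reduced_system r k F A B"
      by (simp add: reduced_system_def)
  next
    fix P P' :: "'a mat"
    assume P: "P \<in> carrier_mat k k" "P' \<in> carrier_mat k k" "det P = 1" "P * P' = 1\<^sub>m k"
    \<comment> \<open>Here only the lower states change basis, so \<open>?J\<close> stays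
      fixed.\<close>
    let ?P = "four_block_mat (1\<^sub>m r) (0\<^sub>m r k) (0\<^sub>m k r) P"
    let ?P' = "four_block_mat (1\<^sub>m r) (0\<^sub>m r k) (0\<^sub>m k r) P'"
    have "?P * ?P' = 1\<^sub>m (r + k)"
      using P by (subst mult_four_block_mat) auto
    moreover have "det ?P = 1"
      using P by (subst det_four_block_mat_lower_left_zero) auto
    moreover have "?P * ?J = ?J"
      using P by (subst four_block_mult_vcat) auto
    moreover have "?P * ?A = four_block_mat (0\<^sub>m r r) (0\<^sub>m r k) (P * B) (P * A)"
      using P A B by (subst mult_four_block_mat) auto
    moreover have "four_block_mat (0\<^sub>m r r) (0\<^sub>m r k) (P * B) (P * A) * ?P' =
        four_block_mat (0\<^sub>m r r) (0\<^sub>m r k) (P * B) (P * A * P')"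
      using P A B by (subst mult_four_block_mat) auto
    ultimately show "reduced_system r k F (P * A * P') (P * B) = reduced_system r k F A B"
      using conj[of ?P ?P'] P by (auto simp: reduced_system_def)
  }
qed

lemma reduced_system_polynomial:
  assumes "polynomial_on_lines (r + k) (r + k) (r + k) r F"
  shows "polynomial_on_lines k k k r (reduced_system r k F)"
  unfolding polynomial_on_lines_def
proof (intro ballI)
  fix A A' B B' :: "'a mat"
  assume A: "A \<in> carrier_mat k k" "A' \<in> carrier_mat k k" and B: "B \<in> carrier_mat k r" "B' \<in> carrier_mat k r"
  let ?J = "vcat (1\<^sub>m r) (0\<^sub>m k r) :: 'a mat"
  let ?S = "\<lambda>A B. four_block_mat (0\<^sub>m r r) (0\<^sub>m r k) B A"
  have "?S A B + t \<cdot>\<^sub>m ?S A' B' = ?S (A + t \<cdot>\<^sub>m A') (B + t \<cdot>\<^sub>m B')" for t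
    using A B by (simp add: four_block_add_smult[of _ r r _ k _ k])
  moreover have "?J + t \<cdot>\<^sub>m 0\<^sub>m (r + k) r = ?J" for t
    by auto
  ultimately show "\<exists>p. \<forall>t. reduced_system r k F (A + t \<cdot>\<^sub>m A') (B + t \<cdot>\<^sub>m B') = poly p t"
    using polynomial_on_linesD[OF assms, of "?S A B" "?S A' B'" ?J "0\<^sub>m (r + k) r"] A B
    by (simp add: reduced_system_def)
qed

text \<open>Induction on the number of states with the number \<open>r\<close> of inputs fixed: the
  descent goes from \<open>r + k\<close> states to \<open>k\<close>, which is smaller because
  \<open>0 < r\<close>, and stops at \<open>feedback_shift_wide\<close>.\<close>

lemma feedback_shift:
  fixes F :: "'a::field mat \<Rightarrow> 'a mat \<Rightarrow> 'a"
  assumes inf: "infinite (UNIV :: 'a set)" and "0 < r"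
    and "feedback_invariant m r F" "polynomial_on_lines m m m r F"
    and "A \<in> carrier_mat m m" "B \<in> carrier_mat m r"
  shows "F (A + c \<cdot>\<^sub>m 1\<^sub>m m) B = F A B"
  using assms(3-)
proof (induction m arbitrary: F A B rule: less_induct)
  case (less m)
  note F = less.prems(1,2) and A = less.prems(3) and B = less.prems(4)
  show ?case
  proof (cases "m \<le> r")
    case True
    then obtain k where "r = m + k"
      using le_Suc_ex by blast
    then show ?thesis
      using feedback_shift_wide[OF inf, of m k F A B c] less.prems by simp
  next
    case False
    then obtain k where m: "m = r + k" "0 < k"
      by (metis less_imp_add_positive not_le)
    note F = F[unfolded m(1)] and A = A[unfolded m(1)] and B = B[unfolded m(1)]
    let ?J = "vcat (1\<^sub>m r) (0\<^sub>m k r) :: 'a mat" and ?c = "c \<cdot>\<^sub>m 1\<^sub>m (r + k)"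
    \<comment> \<open>At the normal form, the upper part of the scalar shift falls into the rows
      that feedback erases. What remains is a scalar shift of the reduced state matrix
      \<open>Z4\<close>, covered by the induction hypothesis.\<close>
    have J: "F (Z + ?c) ?J = F Z ?J" if Z: "Z \<in> carrier_mat (r + k) (r + k)" for Z
    proof -
      obtain Z1 Z2 Z3 Z4 where Zs: "Z1 \<in> carrier_mat r r" "Z2 \<in> carrier_mat r k"
        "Z3 \<in> carrier_mat k r" "Z4 \<in> carrier_mat k k" and Z_eq: "Z = four_block_mat Z1 Z2 Z3 Z4"
        using four_block_cases[OF Z] .
      have "Z + ?c = four_block_mat (Z1 + c \<cdot>\<^sub>m 1\<^sub>m r) Z2 Z3 (Z4 + c \<cdot>\<^sub>m 1\<^sub>m k)"
        unfolding Z_eq four_block_one_mat[symmetric] using Zs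
        by (subst four_block_add_smult[of _ r r _ k _ k]) auto
      then have "F (Z + ?c) ?J = reduced_system r k F (Z4 + c \<cdot>\<^sub>m 1\<^sub>m k) Z3"
        using Zs by (simp add: reduced_system_eq[OF F(1)])
      also have "\<dots> = reduced_system r k F Z4 Z3"
        using m \<open>0 < r\<close> Zs F
        by (intro less.IH reduced_system_invariant reduced_system_polynomial) auto
      also have "\<dots> = F Z ?J"
        using Zs by (simp add: Z_eq reduced_system_eq[OF F(1)])
      finally show ?thesis .
    qed
    obtain M N where MN: "M \<in> carrier_mat r r" "N \<in> carrier_mat k r" "B = vcat M N"
      using vcat_cases[OF B] .
    have "F (A + ?c) B = F A B"
    proof (rule eq_if_eq_generic[OF inf F(2) _ A B])
      show "finite {t. det (M + t \<cdot>\<^sub>m 1\<^sub>m r) = 0}"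
        using finite_singular_shifts MN(1) .
      fix t assume t: "t \<notin> {t. det (M + t \<cdot>\<^sub>m 1\<^sub>m r) = 0}"
      have Bt: "B + t \<cdot>\<^sub>m ?J = vcat (M + t \<cdot>\<^sub>m 1\<^sub>m r) N"
        using MN by (simp add: vcat_add_smult[of _ r r _ k])
      have "M + t \<cdot>\<^sub>m 1\<^sub>m r \<in> carrier_mat r r" "det (M + t \<cdot>\<^sub>m 1\<^sub>m r) \<noteq> 0"
        using MN t by auto
      then obtain P where P: "P \<in> carrier_mat (r + k) (r + k)" "det P = 1" "P * (B + t \<cdot>\<^sub>m ?J) = ?J"
        unfolding Bt using sl_normalize_vcat[OF _ _ MN(2) \<open>0 < k\<close>] by metis
      then obtain P' where P': "P' \<in> carrier_mat (r + k) (r + k)" "P * P' = 1\<^sub>m (r + k)"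
        using obtain_inverse_mat[of P "r + k"] by auto
      have F_conj: "F Z (B + t \<cdot>\<^sub>m ?J) = F (P * Z * P') ?J" if "Z \<in> carrier_mat (r + k) (r + k)" for Z
        using feedback_invariantD(3)[OF F(1) that, of "B + t \<cdot>\<^sub>m ?J" P P'] P P' MN by (simp add: Bt)
      \<comment> \<open>Scalar matrices are central, so conjugation into the normal form leaves the
        shift unchanged.\<close>
      have "P * (A + ?c) * P' = P * A * P' + P * ?c * P'"
        using A P P' by (simp add: mult_add_distrib_mat[of _ "r + k" "r + k" _ "r + k"]
            add_mult_distrib_mat[of _ "r + k" "r + k" _ _ "r + k"])
      also have "P * ?c * P' = ?c"
        using P P' by (simp add: mult_smult_distrib[of _ "r + k" "r + k" _ "r + k"]
            mult_smult_assoc_mat[of _ "r + k" "r + k" _ "r + k"])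
      finally show "F (A + ?c) (B + t \<cdot>\<^sub>m ?J) = F A (B + t \<cdot>\<^sub>m ?J)"
        using A P P' by (simp add: F_conj J)
    qed (use A in auto)
    then show ?thesis
      by (simp add: m)
  qed
qed


section \<open>Matrix pencils\<close>

text \<open>\<open>P\<close> stands here without the transpose of the action; since transposition
  preserves determinants, the condition is the same.\<close>

definition pencil_invariant :: "nat \<Rightarrow> nat \<Rightarrow> ('a::field mat \<Rightarrow> 'a mat \<Rightarrow> 'a) \<Rightarrow> bool" where
  "pencil_invariant m n \<Phi> \<longleftrightarrow>
    (\<forall>X \<in> carrier_mat m n. \<forall>Y \<in> carrier_mat m n. \<forall>P \<in> carrier_mat m m. \<forall>Q \<in> carrier_mat n n.
      det P = 1 \<longrightarrow> det Q = 1 \<longrightarrow> \<Phi> (P * X * Q) (P * Y * Q) = \<Phi> X Y)"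

lemma pencil_invariantD:
  assumes "pencil_invariant m n \<Phi>" "X \<in> carrier_mat m n" "Y \<in> carrier_mat m n"
    and "P \<in> carrier_mat m m" "Q \<in> carrier_mat n n" "det P = 1" "det Q = 1"
  shows "\<Phi> (P * X * Q) (P * Y * Q) = \<Phi> X Y"
  using assms unfolding pencil_invariant_def by blast

text \<open>The feedback group sits in the stabilizer of \<open>Y = (1, 0)\<close>: feedback and
  input changes act by block triangular \<open>Q\<close> alone, and a change of state basis pairs
  \<open>P\<close> on the left with its inverse in the leading block of \<open>Q\<close>.\<close>

lemma pencil_feedback_invariant:
  fixes \<Phi> :: "'a::field mat \<Rightarrow> 'a mat \<Rightarrow> 'a"
  assumes inv: "pencil_invariant m (m + r) \<Phi>"
  shows "feedback_invariant m r (\<lambda>A B. \<Phi> (hcat A B) (hcat (1\<^sub>m m) (0\<^sub>m m r)))"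
  unfolding feedback_invariant_def
proof (intro ballI conjI impI)
  fix A B :: "'a mat" assume A: "A \<in> carrier_mat m m" and B: "B \<in> carrier_mat m r"
  let ?Y = "hcat (1\<^sub>m m) (0\<^sub>m m r) :: 'a mat"
  have c: "hcat A B \<in> carrier_mat m (m + r)" "?Y \<in> carrier_mat m (m + r)"
    using A B by auto
  note inv' = pencil_invariantD[OF inv c]
  {
    fix R :: "'a mat" assume R: "R \<in> carrier_mat r m"
    let ?Q = "four_block_mat (1\<^sub>m m) (0\<^sub>m m r) R (1\<^sub>m r)"
    have "det ?Q = 1"
      using R by (subst det_four_block_mat_upper_right_zero) auto
    moreover have "hcat A B * ?Q = hcat (A + B * R) B"
      using A B R by (subst hcat_mult_four_block) auto
    moreover have "?Y * ?Q = ?Y"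
      using R by (subst hcat_mult_four_block) auto
    ultimately show "\<Phi> (hcat (A + B * R) B) ?Y = \<Phi> (hcat A B) ?Y"
      using inv'[of "1\<^sub>m m" ?Q] c R by simp
  next
    fix S :: "'a mat" assume S: "S \<in> carrier_mat r r" "det S = 1"
    let ?Q = "four_block_mat (1\<^sub>m m) (0\<^sub>m m r) (0\<^sub>m r m) S"
    have "det ?Q = 1"
      using S by (subst det_four_block_mat_upper_right_zero) auto
    moreover have "hcat A B * ?Q = hcat A (B * S)"
      using A B S by (subst hcat_mult_four_block) auto
    moreover have "?Y * ?Q = ?Y"
      using S by (subst hcat_mult_four_block) auto
    ultimately show "\<Phi> (hcat A (B * S)) ?Y = \<Phi> (hcat A B) ?Y"
      using inv'[of "1\<^sub>m m" ?Q] c S by simp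
  next
    fix P P' :: "'a mat"
    assume P: "P \<in> carrier_mat m m" "P' \<in> carrier_mat m m" "det P = 1" "P * P' = 1\<^sub>m m"
    have "det P' = 1"
      using det_mult[OF P(1,2)] P by simp
    let ?Q = "four_block_mat P' (0\<^sub>m m r) (0\<^sub>m r m) (1\<^sub>m r)"
    have "det ?Q = 1"
      using P \<open>det P' = 1\<close> by (subst det_four_block_mat_upper_right_zero) auto
    moreover have "P * hcat A B * ?Q = hcat (P * A * P') (P * B)"
      using A B P by (simp add: mult_hcat[of _ m m _ m _ r] hcat_mult_four_block[of _ m m _ r _ m _ r])
    moreover have "P * ?Y * ?Q = ?Y"
      using P by (simp add: mult_hcat[of _ m m _ m _ r] hcat_mult_four_block[of _ m m _ r _ m _ r])
    ultimately show "\<Phi> (hcat (P * A * P') (P * B)) ?Y = \<Phi> (hcat A B) ?Y"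
      using inv'[of P ?Q] P by simp
  }
qed

lemma pencil_feedback_polynomial:
  fixes \<Phi> :: "'a::field mat \<Rightarrow> 'a mat \<Rightarrow> 'a"
  assumes poly: "polynomial_on_lines m (m + r) m (m + r) \<Phi>"
  shows "polynomial_on_lines m m m r (\<lambda>A B. \<Phi> (hcat A B) (hcat (1\<^sub>m m) (0\<^sub>m m r)))"
  unfolding polynomial_on_lines_def
proof (intro ballI)
  fix A A' B B' :: "'a mat"
  assume A: "A \<in> carrier_mat m m" "A' \<in> carrier_mat m m" and B: "B \<in> carrier_mat m r" "B' \<in> carrier_mat m r"
  let ?Y = "hcat (1\<^sub>m m) (0\<^sub>m m r) :: 'a mat"
  have "hcat A B + t \<cdot>\<^sub>m hcat A' B' = hcat (A + t \<cdot>\<^sub>m A') (B + t \<cdot>\<^sub>m B')" for t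
    using A B by (intro hcat_add_smult) auto
  moreover have "?Y + t \<cdot>\<^sub>m 0\<^sub>m m (m + r) = ?Y" for t
    by auto
  ultimately show "\<exists>p. \<forall>t. \<Phi> (hcat (A + t \<cdot>\<^sub>m A') (B + t \<cdot>\<^sub>m B')) ?Y = poly p t"
    using polynomial_on_linesD[OF poly, of "hcat A B" "hcat A' B'" ?Y "0\<^sub>m m (m + r)"] A B by simp
qed

text \<open>Once a generic \<open>Y\<close> has been moved to \<open>(1, 0)\<close>, adding
  \<open>cY\<close> to \<open>X = (A, B)\<close> is the scalar shift of \<open>A\<close> treated by
  \<open>feedback_shift\<close>.\<close>

lemma pencil_shift:
  fixes \<Phi> :: "'a::field mat \<Rightarrow> 'a mat \<Rightarrow> 'a"
  assumes inf: "infinite (UNIV :: 'a set)" and "m < n"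
    and inv: "pencil_invariant m n \<Phi>" and poly: "polynomial_on_lines m n m n \<Phi>"
    and X: "X \<in> carrier_mat m n" and Y: "Y \<in> carrier_mat m n"
  shows "\<Phi> (X + c \<cdot>\<^sub>m Y) Y = \<Phi> X Y"
proof -
  obtain r where n: "n = m + r" "0 < r"
    using \<open>m < n\<close> less_imp_add_positive by metis
  note inv = inv[unfolded n(1)] and poly = poly[unfolded n(1)] and X = X[unfolded n(1)] and Y = Y[unfolded n(1)]
  let ?J = "hcat (1\<^sub>m m) (0\<^sub>m m r) :: 'a mat"
  have J: "\<Phi> (Z + c \<cdot>\<^sub>m ?J) ?J = \<Phi> Z ?J" if Z: "Z \<in> carrier_mat m (m + r)" for Z
  proof -
    obtain A B where AB: "A \<in> carrier_mat m m" "B \<in> carrier_mat m r" "Z = hcat A B"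
      using hcat_cases[OF Z] .
    have "Z + c \<cdot>\<^sub>m ?J = hcat (A + c \<cdot>\<^sub>m 1\<^sub>m m) B"
      using AB by (simp add: hcat_add_smult[of _ m m _ r])
    then show ?thesis
      using feedback_shift[OF inf \<open>0 < r\<close> pencil_feedback_invariant[OF inv]
          pencil_feedback_polynomial[OF poly] AB(1,2), of c] AB by simp
  qed
  text \<open>Both sides are compared along the lines \<open>(X + cY + tcJ, Y + tJ)\<close> and \<open>(X, Y + tJ)\<close>.\<close>
  obtain M N where MN: "M \<in> carrier_mat m m" "N \<in> carrier_mat m r" "Y = hcat M N"
    using hcat_cases[OF Y] .
  have Yt: "Y + t \<cdot>\<^sub>m ?J = hcat (M + t \<cdot>\<^sub>m 1\<^sub>m m) N" for t
    using MN by (simp add: hcat_add_smult[of _ m m _ r])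
  obtain p where p: "\<And>t. \<Phi> (X + c \<cdot>\<^sub>m Y + t \<cdot>\<^sub>m (c \<cdot>\<^sub>m ?J)) (Y + t \<cdot>\<^sub>m ?J) = poly p t"
    using polynomial_on_linesD[OF poly, of "X + c \<cdot>\<^sub>m Y" "c \<cdot>\<^sub>m ?J" Y ?J] X Y by auto
  obtain q where q: "\<And>t. \<Phi> (X + t \<cdot>\<^sub>m 0\<^sub>m m (m + r)) (Y + t \<cdot>\<^sub>m ?J) = poly q t"
    using polynomial_on_linesD[OF poly, of X "0\<^sub>m m (m + r)" Y ?J] X Y by auto
  have "p = q"
  proof (rule poly_eqI_cofinite[OF inf])
    show "finite {t. det (M + t \<cdot>\<^sub>m 1\<^sub>m m) = 0}"
      using finite_singular_shifts MN(1) .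
    fix t assume "t \<notin> {t. det (M + t \<cdot>\<^sub>m 1\<^sub>m m) = 0}"
    then have "M + t \<cdot>\<^sub>m 1\<^sub>m m \<in> carrier_mat m m" "det (M + t \<cdot>\<^sub>m 1\<^sub>m m) \<noteq> 0"
      using MN by auto
    then obtain Q where Q: "Q \<in> carrier_mat (m + r) (m + r)" "det Q = 1" "(Y + t \<cdot>\<^sub>m ?J) * Q = ?J"
      unfolding Yt using sl_normalize_hcat[OF _ _ MN(2) \<open>0 < r\<close>] by metis
    have Yt_c: "Y + t \<cdot>\<^sub>m ?J \<in> carrier_mat m (m + r)"
      using Y by auto
    have \<Phi>Q: "\<Phi> Z (Y + t \<cdot>\<^sub>m ?J) = \<Phi> (Z * Q) ?J" if "Z \<in> carrier_mat m (m + r)" for Z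
      using pencil_invariantD[OF inv that Yt_c, of "1\<^sub>m m" Q] that Q
      by (simp add: left_mult_one_mat[OF Yt_c])
    have "?J \<in> carrier_mat m (m + r)"
      by auto
    \<comment> \<open>The direction \<open>c ?J\<close> of the first line was chosen so that the
      shift is by \<open>c\<close> times the perturbed second matrix at every
      \<open>t\<close>.\<close>
    then have "X + c \<cdot>\<^sub>m Y + t \<cdot>\<^sub>m (c \<cdot>\<^sub>m ?J) = X + c \<cdot>\<^sub>m (Y + t \<cdot>\<^sub>m ?J)"
      by (intro eq_matI) (use X Y in \<open>auto simp: algebra_simps dest!: carrier_matD simp del: hcat_carrier\<close>)
    then have "poly p t = \<Phi> (X + c \<cdot>\<^sub>m (Y + t \<cdot>\<^sub>m ?J)) (Y + t \<cdot>\<^sub>m ?J)"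
      by (simp flip: p)
    also have "\<dots> = \<Phi> ((X + c \<cdot>\<^sub>m (Y + t \<cdot>\<^sub>m ?J)) * Q) ?J"
      using X Yt_c by (intro \<Phi>Q) auto
    also have "(X + c \<cdot>\<^sub>m (Y + t \<cdot>\<^sub>m ?J)) * Q = X * Q + c \<cdot>\<^sub>m ?J"
      using X Yt_c Q by (simp add: add_mult_distrib_mat[of _ m "m + r" _ _ "m + r"]
          mult_smult_assoc_mat[of _ m "m + r" _ "m + r"])
    also have "\<Phi> (X * Q + c \<cdot>\<^sub>m ?J) ?J = \<Phi> X (Y + t \<cdot>\<^sub>m ?J)"
      using X Q by (simp add: J \<Phi>Q)
    also have "\<dots> = poly q t"
      using X by (simp flip: q)
    finally show "poly p t = poly q t" .
  qed
  moreover have "0 \<cdot>\<^sub>m Z = 0\<^sub>m m (m + r)" if "Z \<in> carrier_mat m (m + r)" for Z :: "'a mat"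
    using that by (intro eq_matI) auto
  then have "X + c \<cdot>\<^sub>m Y + 0 \<cdot>\<^sub>m (c \<cdot>\<^sub>m ?J) = X + c \<cdot>\<^sub>m Y"
    "X + 0 \<cdot>\<^sub>m 0\<^sub>m m (m + r) = X" "Y + 0 \<cdot>\<^sub>m ?J = Y"
    using X Y by simp_all
  ultimately show ?thesis
    by (metis p q)
qed

text \<open>The determinant condition lets the substitution be factored into transvections, and each
  of these is an instance of \<open>pencil_shift\<close>.\<close>

lemma pencil_SL2:
  fixes \<Phi> :: "'a::field mat \<Rightarrow> 'a mat \<Rightarrow> 'a"
  assumes inf: "infinite (UNIV :: 'a set)" and "m < n"
    and inv: "pencil_invariant m n \<Phi>" and poly: "polynomial_on_lines m n m n \<Phi>"
    and X: "X \<in> carrier_mat m n" and Y: "Y \<in> carrier_mat m n" and "a * d - b * c = 1"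
  shows "\<Phi> (a \<cdot>\<^sub>m X + c \<cdot>\<^sub>m Y) (b \<cdot>\<^sub>m X + d \<cdot>\<^sub>m Y) = \<Phi> X Y"
proof -
  have upper: "\<Phi> (X + c \<cdot>\<^sub>m Y) Y = \<Phi> X Y" if "X \<in> carrier_mat m n" "Y \<in> carrier_mat m n" for X Y c
    using pencil_shift[OF inf \<open>m < n\<close> inv poly that] .
  \<comment> \<open>Both hypotheses on the function are symmetric in the two matrices, so exchanging
    them yields the opposite transvections.\<close>
  have inv': "pencil_invariant m n (\<lambda>X Y. \<Phi> Y X)"
    unfolding pencil_invariant_def by (intro ballI impI pencil_invariantD[OF inv])
  have poly': "polynomial_on_lines m n m n (\<lambda>X Y. \<Phi> Y X)"
    unfolding polynomial_on_lines_def by (intro ballI polynomial_on_linesD[OF poly])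
  have lower: "\<Phi> X (Y + b \<cdot>\<^sub>m X) = \<Phi> X Y" if "X \<in> carrier_mat m n" "Y \<in> carrier_mat m n" for X Y b
    using pencil_shift[OF inf \<open>m < n\<close> inv' poly' that(2,1)] .
  have *: "\<Phi> (a \<cdot>\<^sub>m X + c \<cdot>\<^sub>m Y) (b \<cdot>\<^sub>m X + d \<cdot>\<^sub>m Y) = \<Phi> X Y" if "c \<noteq> 0" "a * d - b * c = 1" for a b c d
  proof -
    \<comment> \<open>For nonzero \<open>c\<close> three transvections with parameters
      \<open>p\<close>, \<open>c\<close>, \<open>q\<close> suffice: the diagonal entries
      \<open>a\<close> and \<open>d\<close> determine \<open>p\<close> and \<open>q\<close>, and the
      determinant then gives the right \<open>b\<close>.\<close>
    define p q where "p = (a - 1) / c" and "q = (d - 1) / c"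
    have pq: "c * p = a - 1" "q * c = d - 1"
      using \<open>c \<noteq> 0\<close> by (simp_all add: p_def q_def)
    have b: "b = p + q * a"
      using that by (simp add: p_def q_def field_simps)
    let ?Y = "Y + p \<cdot>\<^sub>m X"
    have "X + c \<cdot>\<^sub>m ?Y = (1 + c * p) \<cdot>\<^sub>m X + c \<cdot>\<^sub>m Y"
      using X Y by (intro eq_matI) (auto simp: algebra_simps)
    then have 1: "X + c \<cdot>\<^sub>m ?Y = a \<cdot>\<^sub>m X + c \<cdot>\<^sub>m Y"
      by (simp add: pq)
    have "?Y + q \<cdot>\<^sub>m (a \<cdot>\<^sub>m X + c \<cdot>\<^sub>m Y) = (p + q * a) \<cdot>\<^sub>m X + (1 + q * c) \<cdot>\<^sub>m Y"
      using X Y by (intro eq_matI) (auto simp: algebra_simps)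
    then have 2: "?Y + q \<cdot>\<^sub>m (a \<cdot>\<^sub>m X + c \<cdot>\<^sub>m Y) = b \<cdot>\<^sub>m X + d \<cdot>\<^sub>m Y"
      by (simp add: pq b)
    have "\<Phi> X Y = \<Phi> X ?Y"
      using X Y by (simp add: lower)
    also have "\<dots> = \<Phi> (X + c \<cdot>\<^sub>m ?Y) ?Y"
      using X Y by (simp add: upper)
    also have "\<dots> = \<Phi> (a \<cdot>\<^sub>m X + c \<cdot>\<^sub>m Y) (?Y + q \<cdot>\<^sub>m (a \<cdot>\<^sub>m X + c \<cdot>\<^sub>m Y))"
      unfolding 1 using X Y by (intro lower[symmetric]) auto
    finally show ?thesis
      by (simp add: 2)
  qed
  show ?thesis
  proof (cases "c = 0")
    case True
    \<comment> \<open>If \<open>c = 0\<close> then \<open>a * d = 1\<close>, so one further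
      transvection, adding the second combination to the first, puts the nonzero \<open>d\<close> in
      the place of \<open>c\<close>.\<close>
    with assms(7) have "d \<noteq> 0" and 1: "(a + b) * d - b * (c + d) = 1"
      by (auto simp: algebra_simps)
    have "a \<cdot>\<^sub>m X + c \<cdot>\<^sub>m Y + 1 \<cdot>\<^sub>m (b \<cdot>\<^sub>m X + d \<cdot>\<^sub>m Y) = (a + b) \<cdot>\<^sub>m X + (c + d) \<cdot>\<^sub>m Y"
      using X Y by (intro eq_matI) (auto simp: algebra_simps)
    then have "\<Phi> (a \<cdot>\<^sub>m X + c \<cdot>\<^sub>m Y) (b \<cdot>\<^sub>m X + d \<cdot>\<^sub>m Y) = \<Phi> ((a + b) \<cdot>\<^sub>m X + (c + d) \<cdot>\<^sub>m Y) (b \<cdot>\<^sub>m X + d \<cdot>\<^sub>m Y)"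
      using upper[of "a \<cdot>\<^sub>m X + c \<cdot>\<^sub>m Y" "b \<cdot>\<^sub>m X + d \<cdot>\<^sub>m Y" 1] X Y by simp
    also have "\<dots> = \<Phi> X Y"
      by (rule *) (use True \<open>d \<noteq> 0\<close> 1 in auto)
    finally show ?thesis .
  qed (use * assms(7) in auto)
qed


section \<open>Evaluation of polynomials\<close>

lemma Const_power: "Const (a ^ n) = Const a ^ n"
  by (induction n) (simp_all add: Const_mult)

lemma Const_prod: "Const (prod f A) = (\<Prod>x\<in>A. Const (f x))"
  by (induction A rule: infinite_finite_induct) (simp_all add: Const_mult)

lemma Const_eq_iff [simp]: "Const a = Const b \<longleftrightarrow> a = b"
  unfolding Const_def by (metis lookup_single_eq)

definition peval :: "('v \<Rightarrow> 'k) \<Rightarrow> ('v, 'k::comm_ring_1) mpoly \<Rightarrow> 'k" where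
  "peval x f = (\<Sum>u\<in>Poly_Mapping.keys f. Poly_Mapping.lookup f u * mono_subst x u)"

text \<open>Evaluation becomes a substitution of constants, so the homomorphism laws of
  \<open>poly_subst\<close> transfer to \<open>peval\<close> by injectivity of
  \<open>Const\<close>.\<close>

lemma Const_peval: "Const (peval x f) = poly_subst (\<lambda>v. Const (x v)) f"
  by (simp add: peval_def poly_subst_def mono_subst_def Const_sum Const_mult Const_prod Const_power)

lemma peval_eqI: "poly_subst (\<lambda>v. Const (x v)) f = Const c \<Longrightarrow> peval x f = c"
  by (simp flip: Const_peval)

lemma peval_Const [simp]: "peval x (Const c) = c"
  and peval_Var [simp]: "peval x (Var v) = x v"
  and peval_add [simp]: "peval x (f + g) = peval x f + peval x g"
  and peval_mult [simp]: "peval x (f * g) = peval x f * peval x g"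
  and peval_sum: "peval x (sum F A) = (\<Sum>a\<in>A. peval x (F a))"
  by (rule peval_eqI, simp add: poly_subst_add poly_subst_mult poly_subst_sum Const_add Const_mult
      Const_sum Const_peval)+

lemma peval_poly_subst: "peval x (poly_subst \<sigma> f) = peval (\<lambda>v. peval x (\<sigma> v)) f"
  by (rule peval_eqI) (simp add: Const_peval poly_subst_poly_subst)

lemma peval_polynomial_on_line:
  fixes f :: "('v, 'k::comm_ring_1) mpoly"
  shows "\<exists>p. \<forall>t. peval (\<lambda>v. a v + t * b v) f = poly p t"
proof -
  \<comment> \<open>The polynomial \<open>f\<close> evaluated over the univariate polynomial ring at
    the linear polynomials \<open>[:a v, b v:]\<close>.\<close>
  let ?p = "\<Sum>u\<in>Poly_Mapping.keys f. Polynomial.smult (Poly_Mapping.lookup f u) (mono_subst (\<lambda>v. [:a v, b v:]) u)"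
  have "peval (\<lambda>v. a v + t * b v) f = poly ?p t" for t
    by (simp add: peval_def mono_subst_def poly_sum poly_prod)
  then show ?thesis by blast
qed

section \<open>Polynomials over an infinite field are determined by their values\<close>

lemma ex_separating_weights:
  fixes N :: nat
  assumes "finite A"
  shows "\<exists>w. \<forall>u u'. (\<forall>a\<in>A. u a < N \<and> u' a < N) \<longrightarrow>
    (\<Sum>a\<in>A. w a * u a) = (\<Sum>a\<in>A. w a * u' a) \<longrightarrow> (\<forall>a\<in>A. u a = u' a)"
  using assms
proof (induction A rule: finite_induct)
  case (insert b A)
  then obtain w where w: "\<And>u u'. \<forall>a\<in>A. u a < N \<and> u' a < N \<Longrightarrow>
      (\<Sum>a\<in>A. w a * u a) = (\<Sum>a\<in>A. w a * u' a) \<Longrightarrow> \<forall>a\<in>A. u a = u' a"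
    by blast
  \<comment> \<open>The new weight exceeds every weighted sum over \<open>A\<close> with entries
    below \<open>N\<close>. As in a mixed radix expansion, division by \<open>W\<close> then
    recovers the new exponent; \<open>Suc\<close> makes the bound strict.\<close>
  define W where "W = Suc (\<Sum>a\<in>A. w a * N)"
  have less: "(\<Sum>a\<in>A. w a * u a) < W" if "\<forall>a\<in>A. u a < N" for u
    unfolding W_def using that by (intro le_imp_less_Suc sum_mono mult_le_mono) auto
  have sum: "(\<Sum>a\<in>insert b A. (w(b := W)) a * u a) = W * u b + (\<Sum>a\<in>A. w a * u a)" for u
  proof -
    have "(\<Sum>a\<in>A. (w(b := W)) a * u a) = (\<Sum>a\<in>A. w a * u a)"
      using insert.hyps by (intro sum.cong) auto
    then show ?thesis
      using insert.hyps by simp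
  qed
  show ?case
  proof (intro exI[of _ "w(b := W)"] allI impI)
    fix u u' :: "_ \<Rightarrow> nat"
    assume bound: "\<forall>a\<in>insert b A. u a < N \<and> u' a < N"
      and eq': "(\<Sum>a\<in>insert b A. (w(b := W)) a * u a) = (\<Sum>a\<in>insert b A. (w(b := W)) a * u' a)"
    have eq: "W * u b + (\<Sum>a\<in>A. w a * u a) = W * u' b + (\<Sum>a\<in>A. w a * u' a)"
      using eq' unfolding sum .
    have digit: "(W * q + s) div W = q" if "s < W" for q s
      using that by simp
    have "u b = (W * u b + (\<Sum>a\<in>A. w a * u a)) div W"
      using bound less by (subst digit) auto
    also have "\<dots> = u' b"
      unfolding eq using bound less by (subst digit) auto
    finally have "u b = u' b" .
    moreover from this eq have "\<forall>a\<in>A. u a = u' a"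
      using bound by (intro w) auto
    ultimately show "\<forall>a\<in>insert b A. u a = u' a"
      by simp
  qed
qed simp

text \<open>Kronecker substitution \<open>v \<mapsto> t ^ w v\<close> with weights that separate the monomials of \<open>f\<close>.\<close>

lemma mpoly_eq_0_if_peval_eq_0:
  fixes f :: "('v::finite, 'k::field) mpoly"
  assumes inf: "infinite (UNIV :: 'k set)" and zero: "\<And>x. peval x f = 0"
  shows "f = 0"
proof -
  let ?K = "Poly_Mapping.keys f" and ?l = "Poly_Mapping.lookup"
  have "finite ((\<lambda>(u, v). ?l u v) ` (?K \<times> (UNIV :: 'v set)))"
    by (intro finite_imageI finite_cartesian_product) auto
  then obtain N where N: "\<And>u v. u \<in> ?K \<Longrightarrow> ?l u v < N"
    unfolding finite_nat_set_iff_bounded by auto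
  obtain w :: "'v \<Rightarrow> nat" where w: "\<And>u u'. (\<And>a. u a < N \<and> u' a < N) \<Longrightarrow>
      (\<Sum>a\<in>UNIV. w a * u a) = (\<Sum>a\<in>UNIV. w a * u' a) \<Longrightarrow> u = u'"
    using ex_separating_weights[OF finite[of "UNIV :: 'v set"], of N] by (auto simp: fun_eq_iff)
  define W where "W u = (\<Sum>a\<in>UNIV. w a * ?l u a)" for u
  have inj: "W u = W u' \<longleftrightarrow> u = u'" if "u \<in> ?K" "u' \<in> ?K" for u u'
    using w[of "?l u" "?l u'"] N that by (auto simp: W_def intro: poly_mapping_eqI)
  have mono: "mono_subst (\<lambda>v. t ^ w v) u = t ^ W u" for t :: 'k and u
    by (subst mono_subst_superset[of UNIV]) (simp_all add: W_def power_sum power_mult)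
  let ?p = "\<Sum>u\<in>?K. monom (?l f u) (W u)"
  have "?p = 0"
  proof (rule poly_eqI_cofinite[OF inf finite.emptyI])
    show "poly ?p t = poly 0 t" for t
      using zero[of "\<lambda>v. t ^ w v"] by (simp add: peval_def mono poly_sum poly_monom)
  qed
  \<comment> \<open>The weights keep the monomials of \<open>f\<close> apart, so no terms merge and
    the coefficient of \<open>?p\<close> at \<open>W u\<close> is that of \<open>f\<close> at
    \<open>u\<close>.\<close>
  have "?l f u = 0" if u: "u \<in> ?K" for u
  proof -
    have "?l f u = (\<Sum>u'\<in>?K. if u' = u then ?l f u' else 0)"
      using u by simp
    also have "\<dots> = coeff ?p (W u)"
      unfolding coeff_sum coeff_monom using inj u by (intro sum.cong) auto
    finally show ?thesis
      using \<open>?p = 0\<close> by simp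
  qed
  then show ?thesis
    by (intro poly_mapping_eqI) (auto simp: in_keys_iff)
qed

lemma mpoly_eqI_peval:
  fixes f g :: "('v::finite, 'k::field) mpoly"
  assumes "infinite (UNIV :: 'k set)" "\<And>x. peval x f = peval x g"
  shows "f = g"
proof -
  \<comment> \<open>The difference is written so that the rules of \<open>peval\<close> for sums,
    products and constants apply.\<close>
  have "peval x (f + Const (- 1) * g) = 0" for x
    by (simp add: assms(2))
  then have "f + Const (- 1) * g = 0"
    using mpoly_eq_0_if_peval_eq_0 assms(1) by blast
  moreover have "Const (- 1) * g = - g"
    by (metis Const_add Const_0 Const_1 add.left_inverse add_eq_0_iff2 mult_minus1)
  ultimately show ?thesis
    by simp
qed

section \<open>The two actions on points of the tensor space\<close>

definition tensor_point :: "'k ^ 'n ^ 'm \<Rightarrow> 'k ^ 'n ^ 'm \<Rightarrow> 'm \<times> 'n \<times> 2 \<Rightarrow> 'k" where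
  "tensor_point A B = (\<lambda>(i, j, k). if k = 1 then A $ i $ j else B $ i $ j)"

lemma tensor_point_surj:
  fixes x :: "'m::finite \<times> 'n::finite \<times> 2 \<Rightarrow> 'k"
  obtains A B where "x = tensor_point A B"
proof
  show "x = tensor_point (\<chi> i j. x (i, j, 1)) (\<chi> i j. x (i, j, 2))"
  proof (rule ext)
    show "x v = tensor_point (\<chi> i j. x (i, j, 1)) (\<chi> i j. x (i, j, 2)) v" for v
      using exhaust_2[of "snd (snd v)"] by (cases v) (auto simp: tensor_point_def)
  qed
qed

lemma peval_slice_subst:
  "peval x (slice_subst A B f) = peval (tensor_point (map_matrix (peval x) A) (map_matrix (peval x) B)) f"
  unfolding slice_subst_def peval_poly_subst
  by (rule arg_cong[where f = "\<lambda>y. peval y f"]) (auto simp: tensor_point_def fun_eq_iff)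

lemma map_matrix_peval:
  "map_matrix (peval (tensor_point A B)) Xmat = A"
  "map_matrix (peval (tensor_point A B)) Ymat = B"
  "map_matrix (peval x) (map_matrix Const M) = M"
  "map_matrix (peval x) (M' ** N) = map_matrix (peval x) M' ** map_matrix (peval x) N"
  by (simp_all add: Finite_Cartesian_Product.vec_eq_iff Xmat_def Ymat_def tensor_point_def matrix_matrix_mult_def peval_sum)

text \<open>On values the action is precomposition with a map of matrix pairs, which turns invariant
  polynomials into invariant functions.\<close>

lemma peval_act_G:
  "peval (tensor_point A B) (act_G (P, Q) f) =
    peval (tensor_point (transpose P ** A ** Q) (transpose P ** B ** Q)) f"
  by (simp add: act_G_def peval_slice_subst map_matrix_peval map_matrix_transpose)

definition lin_comb :: "'k \<Rightarrow> 'k ^ 'n ^ 'm \<Rightarrow> 'k \<Rightarrow> 'k ^ 'n ^ 'm \<Rightarrow> 'k::comm_ring_1 ^ 'n ^ 'm" where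
  "lin_comb a A b B = (\<chi> i j. a * A $ i $ j + b * B $ i $ j)"

lemma lin_comb_mult: "P ** lin_comb a A b B ** Q = lin_comb a (P ** A ** Q) b (P ** B ** Q)"
  by (simp add: Finite_Cartesian_Product.vec_eq_iff lin_comb_def matrix_matrix_mult_def sum_distrib_left sum_distrib_right
      sum.distrib algebra_simps)

lemma peval_act_SL2:
  "peval (tensor_point A B) (act_SL2 g f) =
    peval (tensor_point (lin_comb (g $ 1 $ 1) A (g $ 2 $ 1) B) (lin_comb (g $ 1 $ 2) A (g $ 2 $ 2) B)) f"
proof -
  have "map_matrix (peval (tensor_point A B)) (\<chi> i j. Const a * Xmat $ i $ j + Const b * Ymat $ i $ j) =
      lin_comb a A b B" for a b
    by (simp add: Finite_Cartesian_Product.vec_eq_iff lin_comb_def Xmat_def Ymat_def tensor_point_def)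
  then show ?thesis
    by (simp add: act_SL2_def peval_slice_subst)
qed

text \<open>At each point this is linearity of left and right matrix multiplication; the infinite
  field lifts the equality from values to polynomials.\<close>

lemma act_G_act_SL2_commute:
  fixes f :: "('m::finite, 'n::finite, 'k::field) tensor_poly"
  assumes inf: "infinite (UNIV :: 'k set)"
  shows "act_G h (act_SL2 g f) = act_SL2 g (act_G h f)"
proof (rule mpoly_eqI_peval[OF inf])
  fix x :: "'m \<times> 'n \<times> 2 \<Rightarrow> 'k"
  obtain A B where x: "x = tensor_point A B"
    by (rule tensor_point_surj)
  show "peval x (act_G h (act_SL2 g f)) = peval x (act_SL2 g (act_G h f))"
    by (cases h) (simp add: x peval_act_G peval_act_SL2 lin_comb_mult)
qed

text \<open>Commutation allows the factors of a product of two pairs to be regrouped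
  componentwise.\<close>

lemma group_action_act_G_SL2:
  assumes comm: "\<And>h g f. act_G h (act_SL2 g f) = act_SL2 g (act_G h (f :: ('m, 'n, 'k) tensor_poly))"
  shows "group_action ((SL \<times>\<times> SL) \<times>\<times> SL) UNIV
    (act_G_SL2 :: _ \<Rightarrow> ('m::finite, 'n::finite, 'k::field) tensor_poly \<Rightarrow> _)"
  by (rule group_action_UNIV)
    (auto simp: DirProd_group group_SL,
     auto simp: SL_def act_G_SL2_def act_G_one act_SL2_one act_G_mult act_SL2_mult comm)


section \<open>Matrices indexed by finite types and by natural numbers\<close>

text \<open>An arbitrary enumeration is enough: renumbering rows and columns by the same bijection
  does not change a determinant.\<close>

definition idx :: "'a::finite \<Rightarrow> nat" where
  "idx = (SOME e. bij_betw e UNIV {0..<CARD('a)})"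

lemma bij_betw_idx: "bij_betw (idx :: 'a::finite \<Rightarrow> nat) UNIV {0..<CARD('a)}"
  unfolding idx_def
  using ex_bij_betw_finite_nat[OF finite[of "UNIV :: 'a set"]] by (rule someI_ex)

lemma idx_less [simp]: "idx (a :: 'a::finite) < CARD('a)"
  using bij_betw_idx[where 'a = 'a] by (auto simp: bij_betw_def)

definition finvec_mat :: "'k mat \<Rightarrow> 'k ^ 'n::finite ^ 'm::finite" where
  "finvec_mat A = (\<chi> i j. A $$ (idx i, idx j))"

lemma finvec_mat_surj:
  fixes M :: "'k ^ 'n::finite ^ 'm::finite"
  obtains A where "A \<in> carrier_mat (CARD('m)) (CARD('n))" "finvec_mat A = M"
proof
  let ?A = "mat (CARD('m)) (CARD('n)) (\<lambda>(i, j). M $ (inv_into UNIV idx i) $ (inv_into UNIV idx j))"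
  have "inj (idx :: 'm \<Rightarrow> nat)" "inj (idx :: 'n \<Rightarrow> nat)"
    using bij_betw_idx by (auto simp: bij_betw_def)
  then show "finvec_mat ?A = M"
    by (simp add: Finite_Cartesian_Product.vec_eq_iff finvec_mat_def)
qed simp

lemma finvec_mat_mult:
  fixes A B :: "'k::comm_ring_1 mat"
  assumes "A \<in> carrier_mat (CARD('l)) (CARD('m))" "B \<in> carrier_mat (CARD('m)) (CARD('n))"
  shows "(finvec_mat (A * B) :: 'k ^ 'n::finite ^ 'l::finite) = (finvec_mat A :: 'k ^ 'm::finite ^ 'l) ** finvec_mat B"
proof -
  have "(A * B) $$ (idx i, idx j) = (\<Sum>k\<in>UNIV. A $$ (idx i, idx (k :: 'm)) * B $$ (idx k, idx j))"
    for i :: 'l and j :: 'n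
  proof -
    have "(A * B) $$ (idx i, idx j) = (\<Sum>k = 0..<CARD('m). A $$ (idx i, k) * B $$ (k, idx j))"
      using assms by (simp add: scalar_prod_def)
    also have "\<dots> = (\<Sum>k\<in>UNIV. A $$ (idx i, idx (k :: 'm)) * B $$ (idx k, idx j))"
      by (rule sum.reindex_bij_betw[OF bij_betw_idx, symmetric])
    finally show ?thesis .
  qed
  then show ?thesis
    by (simp add: Finite_Cartesian_Product.vec_eq_iff finvec_mat_def matrix_matrix_mult_def)
qed

lemma finvec_mat_transpose:
  assumes "A \<in> carrier_mat (CARD('m)) (CARD('n))"
  shows "(finvec_mat (transpose_mat A) :: 'k ^ 'm::finite ^ 'n::finite) = transpose (finvec_mat A)"
  using assms by (simp add: Finite_Cartesian_Product.vec_eq_iff finvec_mat_def transpose_def)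

text \<open>Transport along the enumeration is a sign-preserving bijection between the permutations
  of the type and those of the index range, and it matches the Leibniz terms one by one.\<close>

lemma det_finvec_mat:
  fixes A :: "'k::comm_ring_1 mat"
  assumes A: "A \<in> carrier_mat (CARD('m)) (CARD('m))"
  shows "Determinants.det (finvec_mat A :: 'k ^ 'm::finite ^ 'm) = Determinant.det A"
proof -
  let ?n = "CARD('m)"
  let ?\<phi> = "map_permutation (UNIV :: 'm set) idx"
  let ?t = "\<lambda>p. of_int (sign p) * (\<Prod>i = 0..<?n. A $$ (i, p i))"
  have inj: "inj (idx :: 'm \<Rightarrow> nat)"
    using bij_betw_idx by (auto simp: bij_betw_def)
  have "bij_betw ?\<phi> {p. p permutes UNIV} {p. p permutes {0..<?n}}"
    by (intro bij_betwI[where g = "map_permutation {0..<?n} (inv_into UNIV idx)"])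
      (auto intro!: map_permutation_permutes[OF bij_betw_idx]
        map_permutation_permutes[OF bij_betw_inv_into[OF bij_betw_idx]]
        map_permutation_compose_inv[OF bij_betw_idx]
        map_permutation_compose_inv[OF bij_betw_inv_into[OF bij_betw_idx]]
        simp: inj bij_betw_inv_into_right[OF bij_betw_idx])
  then have "(\<Sum>p | p permutes {0..<?n}. ?t p) = (\<Sum>p | p permutes UNIV. ?t (?\<phi> p))"
    by (rule sum.reindex_bij_betw[symmetric])
  also have "\<dots> = (\<Sum>p | p permutes UNIV. of_int (sign p) * (\<Prod>i\<in>UNIV. A $$ (idx i, idx (p i :: 'm))))"
  proof (rule sum.cong[OF refl])
    fix p :: "'m \<Rightarrow> 'm" assume "p \<in> {p. p permutes UNIV}"
    then have "sign (?\<phi> p) = sign p"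
      using inj by (simp add: sign_map_permutation)
    moreover have "(\<Prod>i = 0..<?n. A $$ (i, ?\<phi> p i)) = (\<Prod>i\<in>UNIV. A $$ (idx i, ?\<phi> p (idx (i :: 'm))))"
      by (rule prod.reindex_bij_betw[OF bij_betw_idx, symmetric])
    ultimately show "?t (?\<phi> p) = of_int (sign p) * (\<Prod>i\<in>UNIV. A $$ (idx i, idx (p i)))"
      using inj by (simp add: map_permutation_apply)
  qed
  finally show ?thesis
    using A by (simp add: Determinants.det_def Determinant.det_def finvec_mat_def)
qed


section \<open>Invariant polynomials\<close>

definition pencil_fun :: "('m::finite, 'n::finite, 'k::field) tensor_poly \<Rightarrow> 'k mat \<Rightarrow> 'k mat \<Rightarrow> 'k" where
  "pencil_fun f X Y = peval (tensor_point (finvec_mat X) (finvec_mat Y)) f"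

lemma pencil_fun_invariant:
  fixes f :: "('m::finite, 'n::finite, 'k::field) tensor_poly"
  assumes f: "f \<in> invariant_ring (SL \<times>\<times> SL) act_G"
  shows "pencil_invariant (CARD('m)) (CARD('n)) (pencil_fun f)"
  unfolding pencil_invariant_def
proof (intro ballI impI)
  fix X Y P Q :: "'k mat"
  assume X: "X \<in> carrier_mat (CARD('m)) (CARD('n))" and Y: "Y \<in> carrier_mat (CARD('m)) (CARD('n))"
    and P: "P \<in> carrier_mat (CARD('m)) (CARD('m))" and Q: "Q \<in> carrier_mat (CARD('n)) (CARD('n))"
    and det: "det P = 1" "det Q = 1"
  \<comment> \<open>The action multiplies by the transpose of its first argument, so the transpose
    of \<open>P\<close> is inserted to obtain \<open>P\<close> itself.\<close>
  let ?P = "finvec_mat (transpose_mat P) :: 'k ^ 'm ^ 'm" and ?Q = "finvec_mat Q :: 'k ^ 'n ^ 'n"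
  have "Determinants.det ?P = 1" "Determinants.det ?Q = 1"
    using P Q det by (simp_all add: det_finvec_mat det_transpose)
  then have act: "act_G (?P, ?Q) f = f"
    using f by (auto simp: invariant_ring_def SL_def)
  have *: "(finvec_mat (P * Z * Q) :: 'k ^ 'n ^ 'm) = transpose ?P ** finvec_mat Z ** ?Q"
    if Z: "Z \<in> carrier_mat (CARD('m)) (CARD('n))" for Z
  proof -
    have "(finvec_mat (P * Z * Q) :: 'k ^ 'n ^ 'm) = finvec_mat (P * Z) ** ?Q"
      using P Z Q by (intro finvec_mat_mult) auto
    also have "(finvec_mat (P * Z) :: 'k ^ 'n ^ 'm) = (finvec_mat P :: 'k ^ 'm ^ 'm) ** finvec_mat Z"
      using P Z by (intro finvec_mat_mult) auto
    also have "(finvec_mat P :: 'k ^ 'm ^ 'm) = transpose ?P"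
      using P by (simp add: finvec_mat_transpose)
    finally show ?thesis .
  qed
  show "pencil_fun f (P * X * Q) (P * Y * Q) = pencil_fun f X Y"
    using peval_act_G[of "finvec_mat X" "finvec_mat Y" ?P ?Q f] X Y
    by (simp add: pencil_fun_def * act)
qed

lemma finvec_mat_add_smult:
  assumes "A \<in> carrier_mat (CARD('m::finite)) (CARD('n::finite))" "B \<in> carrier_mat (CARD('m)) (CARD('n))"
  shows "(finvec_mat (a \<cdot>\<^sub>m A + b \<cdot>\<^sub>m B) :: 'k::comm_ring_1 ^ 'n ^ 'm) = lin_comb a (finvec_mat A) b (finvec_mat B)"
  using assms by (simp add: Finite_Cartesian_Product.vec_eq_iff finvec_mat_def lin_comb_def)

lemma pencil_fun_polynomial:
  fixes f :: "('m::finite, 'n::finite, 'k::field) tensor_poly"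
  shows "polynomial_on_lines (CARD('m)) (CARD('n)) (CARD('m)) (CARD('n)) (pencil_fun f)"
  unfolding polynomial_on_lines_def
proof (intro ballI)
  fix A A' B B' :: "'k mat"
  assume A: "A \<in> carrier_mat (CARD('m)) (CARD('n))" "A' \<in> carrier_mat (CARD('m)) (CARD('n))"
    and B: "B \<in> carrier_mat (CARD('m)) (CARD('n))" "B' \<in> carrier_mat (CARD('m)) (CARD('n))"
  let ?a = "tensor_point (finvec_mat A) (finvec_mat B) :: 'm \<times> 'n \<times> 2 \<Rightarrow> 'k"
  let ?b = "tensor_point (finvec_mat A') (finvec_mat B') :: 'm \<times> 'n \<times> 2 \<Rightarrow> 'k"
  have "pencil_fun f (A + t \<cdot>\<^sub>m A') (B + t \<cdot>\<^sub>m B') = peval (\<lambda>v. ?a v + t * ?b v) f" for t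
    unfolding pencil_fun_def using A B
    by (intro arg_cong[where f = "\<lambda>y. peval y f"])
      (auto simp: fun_eq_iff tensor_point_def finvec_mat_def)
  then show "\<exists>p. \<forall>t. pencil_fun f (A + t \<cdot>\<^sub>m A') (B + t \<cdot>\<^sub>m B') = poly p t"
    using peval_polynomial_on_line[of ?a ?b f] by simp
qed

lemma act_SL2_eq_if_act_G_invariant:
  fixes f :: "('m::finite, 'n::finite, 'k::field) tensor_poly"
  assumes inf: "infinite (UNIV :: 'k set)" and less: "CARD('m) < CARD('n)"
    and f: "f \<in> invariant_ring (SL \<times>\<times> SL) act_G" and g: "g \<in> carrier SL"
  shows "act_SL2 g f = f"
proof (rule mpoly_eqI_peval[OF inf])
  fix x :: "'m \<times> 'n \<times> 2 \<Rightarrow> 'k"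
  obtain M N where x: "x = tensor_point M N"
    by (rule tensor_point_surj)
  obtain X where X: "X \<in> carrier_mat (CARD('m)) (CARD('n))" "finvec_mat X = M"
    by (rule finvec_mat_surj)
  obtain Y where Y: "Y \<in> carrier_mat (CARD('m)) (CARD('n))" "finvec_mat Y = N"
    by (rule finvec_mat_surj)
  \<comment> \<open>The columns of \<open>g\<close> hold the coefficients of the two combinations,
    so \<open>a\<close>, \<open>b\<close>, \<open>c\<close>, \<open>d\<close> of
    \<open>pencil_SL2\<close> are the entries of \<open>g\<close> read row by row.\<close>
  have "g $ 1 $ 1 * g $ 2 $ 2 - g $ 1 $ 2 * g $ 2 $ 1 = 1"
    using g by (simp add: SL_def det_2)
  then have "pencil_fun f (g $ 1 $ 1 \<cdot>\<^sub>m X + g $ 2 $ 1 \<cdot>\<^sub>m Y) (g $ 1 $ 2 \<cdot>\<^sub>m X + g $ 2 $ 2 \<cdot>\<^sub>m Y) = pencil_fun f X Y"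
    by (rule pencil_SL2[OF inf less pencil_fun_invariant[OF f] pencil_fun_polynomial X(1) Y(1)])
  then show "peval x (act_SL2 g f) = peval x f"
    using X Y by (simp add: x peval_act_SL2 pencil_fun_def finvec_mat_add_smult)
qed

theorem theorem4p5:
  assumes "infinite (UNIV :: 'k::field set)"
    and "CARD('m::finite) < CARD('n::finite)"
  shows
    "(\<forall>h \<in> carrier (SL \<times>\<times> SL). \<forall>g \<in> carrier SL. \<forall>f :: ('m, 'n, 'k) tensor_poly.
        act_G h (act_SL2 g f) = act_SL2 g (act_G h f)) \<and>
     group_action ((SL \<times>\<times> SL) \<times>\<times> SL) (UNIV :: ('m, 'n, 'k) tensor_poly set) act_G_SL2 \<and>
     invariant_ring ((SL \<times>\<times> SL) \<times>\<times> SL) act_G_SL2 =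
       (invariant_ring (SL \<times>\<times> SL) act_G :: ('m, 'n, 'k) tensor_poly set)"
proof (intro conjI ballI allI)
  show "act_G h (act_SL2 g f) = act_SL2 g (act_G h f)" for h g and f :: "('m, 'n, 'k) tensor_poly"
    using assms(1) by (rule act_G_act_SL2_commute)
  then show "group_action ((SL \<times>\<times> SL) \<times>\<times> SL) (UNIV :: ('m, 'n, 'k) tensor_poly set) act_G_SL2"
    by (rule group_action_act_G_SL2)
  show "invariant_ring ((SL \<times>\<times> SL) \<times>\<times> SL) act_G_SL2 =
       (invariant_ring (SL \<times>\<times> SL) act_G :: ('m, 'n, 'k) tensor_poly set)"
  proof (intro equalityI subsetI)
    fix f :: "('m, 'n, 'k) tensor_poly"
    assume f: "f \<in> invariant_ring ((SL \<times>\<times> SL) \<times>\<times> SL) act_G_SL2"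
    have "act_G h f = f" if "h \<in> carrier (SL \<times>\<times> SL)" for h
    proof -
      \<comment> \<open>\<open>G\<close> is embedded in the product through the identity of the
        second factor.\<close>
      have "(h, Finite_Cartesian_Product.mat 1) \<in> carrier ((SL \<times>\<times> SL) \<times>\<times> SL)"
        using that by (auto simp: SL_def)
      with f have "act_G_SL2 (h, Finite_Cartesian_Product.mat 1) f = f"
        by (auto simp: invariant_ring_def)
      then show ?thesis
        by (simp add: act_G_SL2_def act_SL2_one)
    qed
    then show "f \<in> invariant_ring (SL \<times>\<times> SL) act_G"
      by (simp add: invariant_ring_def)
  next
    fix f :: "('m, 'n, 'k) tensor_poly"
    assume f: "f \<in> invariant_ring (SL \<times>\<times> SL) act_G"
    then show "f \<in> invariant_ring ((SL \<times>\<times> SL) \<times>\<times> SL) act_G_SL2"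
      using act_SL2_eq_if_act_G_invariant[OF assms f]
      by (auto simp: invariant_ring_def act_G_SL2_def)
  qed
qed

end
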